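(* Consider estimating $\mu$ from $(X,S)$ with unknown $\mu\ge 0$, $\sigma>0$ under loss $\rho\left(\frac{d-\mu}{\sigma}\right)$ with $\rho$ strictly bowl-shaped. Let $\delta_g\in C$, i.e. $\delta_g(X,S)=X+c_0S+g(X/S)S$ with $g$ absolutely continuous, nonincreasing, non-constant and $\lim_{t\to\infty}g(t)=0$. Then $\delta_g$ is minimax whenever either one of the following conditions holds for all $\lambda\ge 0$ and all $y\in\{y: g'(y)<0\}$: (i) $$\int_0^\infty\int_{-\infty}^{vy-\lambda}\rho'(u+c_0v+g(y)v)\,v^n f(u^2+v^2)\,du\,dv\le 0;$$ or (ii) $\rho$ is convex, $g\le g_{\pi_0}$, and $\psi_\rho(\lambda,y)\le 0$, where $$\psi_\rho(\lambda,y)=\int_0^\infty\int_{-\infty}^{vy-\lambda}\rho'(u+c_0v+g_{\pi_0}(y)v)\,v^n f(u^2+v^2)\,du\,dv.$$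
   Context: Model: $n\ge 1$ is an integer and $f:\mathbb{R}^+\to\mathbb{R}^+$ is a known differentiable function with $f'<0$ and $t f'(t)/f(t)$ decreasing in $t$ for $t>0$. One observes $(X,S)\in\mathbb{R}\times(0,\infty)$ with joint density $\frac{s^{n-1}}{\sigma^{n+1}}f\left(\frac{(x-\mu)^2+s^2}{\sigma^2}\right)$ ($f$ suitably normalized), with $\theta=(\mu,\sigma)\in\Theta=\{(\mu,\sigma):\mu\ge0,\sigma>0\}$ unknown. (This is the reduction to $(X,S=\|U\|)$ of $(X,U)\in\mathbb{R}\times\mathbb{R}^n$ with density proportional to $\sigma^{-(n+1)}f(((x-\mu)^2+\|u\|^2)/\sigma^2)$.) Loss: $\rho\left(\frac{d-\mu}{\sigma}\right)$ with $\rho$ absolutely continuous and strictly bowl-shaped: $\rho(t)\ge\rho(0)=0$, $\rho'<0$ on $(-\infty,0)$, $\rho'>0$ on $(0,\infty)$. Risk: $R(\theta,\delta)=E_\theta[\rho((\delta(X,S)-\mu)/\sigma)]$. MRE estimator: $(f,\rho)$ is assumed such that a unique minimum risk equivariant estimator with finite risk exists for the unconstrained problem; it is $\delta_0(X,S)=X+c_0S$, $c_0=\mathrm{argmin}_c E_{0,1}[\rho(X+cS)]$, uniquely determined by $E_{0,1}[S\rho'(X+c_0S)]=0$ (subscript $0,1$ means $\mu=0,\sigma=1$). Its risk is constant, and it is known that $\delta_0$ is minimax over $\Theta$; hence "an estimator $\delta$ is minimax" means $R(\theta,\delta)\le R(\theta,\delta_0)$ for all $\theta\in\Theta$. Bayes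 estimator: $\delta_{\pi_0}$ is the generalized Bayes estimator for the prior $\pi_0(\mu,\sigma)=\sigma^{-1}1_{[0,\infty)}(\mu)1_{(0,\infty)}(\sigma)$, assumed to exist; it has the form $X+c_0S+g_{\pi_0}(X/S)S$, where $g_{\pi_0}(y)$ is the (unique) minimizer in $g$ of $\int_0^\infty\int_{-\infty}^{vy}\rho(u+c_0v+gv)f(u^2+v^2)v^{n-1}\,du\,dv$, and satisfies $\int_0^\infty\int_{-\infty}^{vy}\rho'(u+c_0v+g_{\pi_0}(y)v)\,v^nf(u^2+v^2)\,du\,dv=0$ for all $y\in\mathbb{R}$. Class $C$: the estimators $\delta_g(X,S)=\delta_0(X,S)+g(X/S)S$ with $g:\mathbb{R}\to\mathbb{R}$ absolutely continuous, nonincreasing, non-constant, and $\lim_{t\to\infty}g(t)=0$. *)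

theory Defs
  imports "HOL-Probability.Probability"
begin

(* Absolute continuity on every compact interval; a finite family of non-overlapping
   subintervals is given by the set D of its pairs of endpoints. *)
definition abs_continuous :: "(real \<Rightarrow> real) \<Rightarrow> bool" where
  "abs_continuous F \<longleftrightarrow>
    (\<forall>a b. \<forall>\<epsilon>>0. \<exists>\<delta>>0. \<forall>D :: (real \<times> real) set.
       finite D \<and> (\<forall>(x, y)\<in>D. a \<le> x \<and> x \<le> y \<and> y \<le> b) \<and>
       disjoint_family_on (\<lambda>(x, y). {x<..<y}) D \<and> (\<Sum>(x, y)\<in>D. y - x) < \<delta>
       \<longrightarrow> (\<Sum>(x, y)\<in>D. \<bar>F y - F x\<bar>) < \<epsilon>)"

(* An absolutely continuous function is differentiable only almost everywhere,
   so the sign conditions on the derivative are imposed almost everywhere. *)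
definition strictly_bowl_shaped :: "(real \<Rightarrow> real) \<Rightarrow> bool" where
  "strictly_bowl_shaped \<rho> \<longleftrightarrow>
    abs_continuous \<rho> \<and> \<rho> 0 = 0 \<and> (\<forall>t. \<rho> t \<ge> 0) \<and>
    (AE t in lborel. t < 0 \<longrightarrow> (\<exists>D<0. (\<rho> has_real_derivative D) (at t))) \<and>
    (AE t in lborel. t > 0 \<longrightarrow> (\<exists>D>0. (\<rho> has_real_derivative D) (at t)))"

definition joint_density ::
  "nat \<Rightarrow> (real \<Rightarrow> real) \<Rightarrow> real \<Rightarrow> real \<Rightarrow> real \<Rightarrow> real \<Rightarrow> real" where
  "joint_density n f \<mu> \<sigma> x s =
    (if s > 0 then s ^ (n - 1) / \<sigma> ^ (n + 1) * f (((x - \<mu>)\<^sup>2 + s\<^sup>2) / \<sigma>\<^sup>2) else 0)"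

definition model :: "nat \<Rightarrow> (real \<Rightarrow> real) \<Rightarrow> real \<Rightarrow> real \<Rightarrow> (real \<times> real) measure" where
  "model n f \<mu> \<sigma> = density lborel (\<lambda>(x, s). ennreal (joint_density n f \<mu> \<sigma> x s))"

(* Only the values of f on {0<..} matter. The last conjunct normalizes f. *)
definition model_density :: "nat \<Rightarrow> (real \<Rightarrow> real) \<Rightarrow> bool" where
  "model_density n f \<longleftrightarrow>
    (\<forall>t>0. f t > 0 \<and> f differentiable (at t) \<and> deriv f t < 0) \<and>
    antimono_on {0<..} (\<lambda>t. t * deriv f t / f t) \<and>
    (\<forall>\<mu> \<sigma>. \<sigma> > 0 \<longrightarrow> prob_space (model n f \<mu> \<sigma>))"

definition risk ::
  "nat \<Rightarrow> (real \<Rightarrow> real) \<Rightarrow> (real \<Rightarrow> real) \<Rightarrow> real \<Rightarrow> real \<Rightarrow> (real \<Rightarrow> real \<Rightarrow> real) \<Rightarrow> ennreal"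
where
  "risk n f \<rho> \<mu> \<sigma> \<delta> = (\<integral>\<^sup>+ (x, s). ennreal (\<rho> ((\<delta> x s - \<mu>) / \<sigma>)) \<partial>model n f \<mu> \<sigma>)"

definition equivariant :: "(real \<Rightarrow> real \<Rightarrow> real) \<Rightarrow> bool" where
  "equivariant \<delta> \<longleftrightarrow>
    (\<forall>a>0. \<forall>b x. \<forall>s>0. \<delta> (a * x + b) (a * s) = a * \<delta> x s + b)"

definition unique_MRE ::
  "nat \<Rightarrow> (real \<Rightarrow> real) \<Rightarrow> (real \<Rightarrow> real) \<Rightarrow> (real \<Rightarrow> real \<Rightarrow> real) \<Rightarrow> bool" where
  "unique_MRE n f \<rho> \<delta> \<longleftrightarrow>
    equivariant \<delta> \<and>
    (\<forall>\<mu> \<sigma>. \<sigma> > 0 \<longrightarrow>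
       risk n f \<rho> \<mu> \<sigma> \<delta> < \<infinity> \<and>
       (\<forall>\<delta>'. equivariant \<delta>' \<and> (\<exists>x. \<exists>s>0. \<delta>' x s \<noteq> \<delta> x s)
          \<longrightarrow> risk n f \<rho> \<mu> \<sigma> \<delta> < risk n f \<rho> \<mu> \<sigma> \<delta>'))"

definition delta0 :: "real \<Rightarrow> real \<Rightarrow> real \<Rightarrow> real" where
  "delta0 c x s = x + c * s"

definition delta :: "real \<Rightarrow> (real \<Rightarrow> real) \<Rightarrow> real \<Rightarrow> real \<Rightarrow> real" where
  "delta c g x s = delta0 c x s + g (x / s) * s"

(* The equivariant estimators are the delta0 c, so the second conjunct repeats the first one
   in terms of the constant c0. *)
definition MRE_constant :: "nat \<Rightarrow> (real \<Rightarrow> real) \<Rightarrow> (real \<Rightarrow> real) \<Rightarrow> real \<Rightarrow> bool" where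
  "MRE_constant n f \<rho> c\<^sub>0 \<longleftrightarrow>
    unique_MRE n f \<rho> (delta0 c\<^sub>0) \<and>
    (\<forall>c. c \<noteq> c\<^sub>0 \<longrightarrow>
       (\<integral>\<^sup>+ (x, s). ennreal (\<rho> (x + c\<^sub>0 * s)) \<partial>model n f 0 1)
         < (\<integral>\<^sup>+ (x, s). ennreal (\<rho> (x + c * s)) \<partial>model n f 0 1)) \<and>
    (\<forall>c. integrable (model n f 0 1) (\<lambda>(x, s). s * deriv \<rho> (x + c * s)) \<and>
         (\<integral>(x, s). s * deriv \<rho> (x + c * s) \<partial>model n f 0 1) = 0
         \<longleftrightarrow> c = c\<^sub>0)"

(* Since delta0 c0 is minimax over the parameter space and has constant finite risk, an estimator
   is minimax iff its risk never exceeds that of delta0 c0. *)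
definition minimax ::
  "nat \<Rightarrow> (real \<Rightarrow> real) \<Rightarrow> (real \<Rightarrow> real) \<Rightarrow> real \<Rightarrow> (real \<Rightarrow> real \<Rightarrow> real) \<Rightarrow> bool" where
  "minimax n f \<rho> c\<^sub>0 \<delta> \<longleftrightarrow>
    (\<forall>\<mu> \<sigma>. \<mu> \<ge> 0 \<and> \<sigma> > 0 \<longrightarrow> risk n f \<rho> \<mu> \<sigma> \<delta> \<le> risk n f \<rho> \<mu> \<sigma> (delta0 c\<^sub>0))"

definition class_C :: "(real \<Rightarrow> real) \<Rightarrow> bool" where
  "class_C g \<longleftrightarrow>
    abs_continuous g \<and> antimono g \<and> \<not> (\<exists>k. \<forall>t. g t = k) \<and> (g \<longlongrightarrow> 0) at_top"

definition lower_integral :: "real \<Rightarrow> real \<Rightarrow> (real \<Rightarrow> real \<Rightarrow> real) \<Rightarrow> real" where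
  "lower_integral lam y \<phi> = (LBINT v:{0<..}. (LBINT u:{..v * y - lam}. \<phi> u v))"

(* Absolute convergence of lower_integral; needed because a divergent Bochner integral is 0. *)
definition lower_integrable :: "real \<Rightarrow> real \<Rightarrow> (real \<Rightarrow> real \<Rightarrow> real) \<Rightarrow> bool" where
  "lower_integrable lam y \<phi> \<longleftrightarrow>
    set_integrable lborel {(u, v). 0 < v \<and> u \<le> v * y - lam} (\<lambda>(u, v). \<phi> u v)"

definition score_integrand ::
  "nat \<Rightarrow> (real \<Rightarrow> real) \<Rightarrow> (real \<Rightarrow> real) \<Rightarrow> real \<Rightarrow> real \<Rightarrow> real \<Rightarrow> real \<Rightarrow> real" where
  "score_integrand n f \<rho> c\<^sub>0 k u v = deriv \<rho> (u + c\<^sub>0 * v + k * v) * v ^ n * f (u\<^sup>2 + v\<^sup>2)"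

definition prior :: "real \<Rightarrow> real \<Rightarrow> real" where
  "prior \<mu> \<sigma> = (1 / \<sigma>) * indicator {0..} \<mu> * indicator {0<..} \<sigma>"

definition generalized_Bayes ::
  "nat \<Rightarrow> (real \<Rightarrow> real) \<Rightarrow> (real \<Rightarrow> real) \<Rightarrow> (real \<Rightarrow> real \<Rightarrow> real) \<Rightarrow> bool" where
  "generalized_Bayes n f \<rho> \<delta> \<longleftrightarrow>
    (\<forall>x. \<forall>s>0. \<forall>d.
       (\<integral>\<^sup>+ (\<mu>, \<sigma>). ennreal (\<rho> ((\<delta> x s - \<mu>) / \<sigma>) * joint_density n f \<mu> \<sigma> x s * prior \<mu> \<sigma>) \<partial>lborel)
       \<le> (\<integral>\<^sup>+ (\<mu>, \<sigma>). ennreal (\<rho> ((d - \<mu>) / \<sigma>) * joint_density n f \<mu> \<sigma> x s * prior \<mu> \<sigma>) \<partial>lborel))"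

(* The second conjunct is the generalized Bayes property after the substitution
   u = (x - mu) / sigma, v = s / sigma, y = x / s, with uniqueness. *)
definition Bayes_function ::
  "nat \<Rightarrow> (real \<Rightarrow> real) \<Rightarrow> (real \<Rightarrow> real) \<Rightarrow> real \<Rightarrow> (real \<Rightarrow> real) \<Rightarrow> bool" where
  "Bayes_function n f \<rho> c\<^sub>0 h \<longleftrightarrow>
    generalized_Bayes n f \<rho> (delta c\<^sub>0 h) \<and>
    (\<forall>y k. k \<noteq> h y \<longrightarrow>
       (\<integral>\<^sup>+ v\<in>{0<..}. (\<integral>\<^sup>+ u\<in>{..v * y}.
          ennreal (\<rho> (u + c\<^sub>0 * v + h y * v) * f (u\<^sup>2 + v\<^sup>2) * v ^ (n - 1)) \<partial>lborel) \<partial>lborel)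
       < (\<integral>\<^sup>+ v\<in>{0<..}. (\<integral>\<^sup>+ u\<in>{..v * y}.
          ennreal (\<rho> (u + c\<^sub>0 * v + k * v) * f (u\<^sup>2 + v\<^sup>2) * v ^ (n - 1)) \<partial>lborel) \<partial>lborel)) \<and>
    (\<forall>y. lower_integrable 0 y (score_integrand n f \<rho> c\<^sub>0 (h y)) \<and>
         lower_integral 0 y (score_integrand n f \<rho> c\<^sub>0 (h y)) = 0)"

definition psi ::
  "nat \<Rightarrow> (real \<Rightarrow> real) \<Rightarrow> (real \<Rightarrow> real) \<Rightarrow> real \<Rightarrow> (real \<Rightarrow> real) \<Rightarrow> real \<Rightarrow> real \<Rightarrow> real" where
  "psi n f \<rho> c\<^sub>0 h lam y = lower_integral lam y (score_integrand n f \<rho> c\<^sub>0 (h y))"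

end

theory Submission
  imports Defs
begin

text \<open>Write \<open>u = (x - \<mu>) / \<sigma>\<close>, \<open>v = s / \<sigma>\<close> and \<open>\<lambda> = \<mu> / \<sigma>\<close>. The loss of \<open>\<delta>\<^sub>g\<close> exceeds that of \<open>\<delta>\<^sub>0\<close> by the integral
  of \<open>\<rho>'(u + c\<^sub>0 v + k v) v\<close> over the levels \<open>0 < k \<le> g((u + \<lambda>) / v)\<close>. Integrating first over \<open>(u, v)\<close>, the level
  \<open>k\<close> contributes the integral over \<open>{u \<le> v y - \<lambda>}\<close> with \<open>g y = k\<close>, which the hypotheses make nonpositive as
  soon as \<open>g'(y) < 0\<close>. Parametrizing by the level \<open>k\<close> instead of by \<open>y\<close> avoids the chain rule for
  \<open>\<rho> \<circ> g\<close>; what is needed is that \<open>g\<close> maps the points without a negative derivative to a null set. This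
  combines Lebesgue's differentiation theorem, the Lusin property and Sard's lemma for monotone
  absolutely continuous functions, and follows from two Vitali covering estimates for the outer measure of images.\<close>

section \<open>Absolutely continuous functions\<close>

text \<open>The points where \<open>g\<close> lacks a negative derivative may fill a set of positive
  measure (\<open>g\<close> can be constant on intervals), so no property of almost every y is
  available. Only the set of their values is null, which is why Lebesgue measure is put on the
  levels. Monotonicity makes each set {k <= g} either empty or a half-line ending at a point of
  level k, so a single y per level suffices. The exceptional sets are not shown to be measurable;
  hence the outer measure of images. The derivative of \<open>\<rho>\<close> is also known only off
  a null set of the line. For fixed k, the pairs (u, v) at which it is evaluated there form a null
  set of the plane. Condition (ii) fits the pattern of (i) because convexity makes the derivative of
  \<open>\<rho>\<close> nondecreasing: replacing the level by the larger Bayes value can only raise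
  the integrand.\<close>

lemma abs_continuousE:
  assumes "abs_continuous F" "\<epsilon> > 0"
  obtains \<delta> where "\<delta> > 0" "\<And>D. \<lbrakk>finite D; \<And>x y. (x, y) \<in> D \<Longrightarrow> a \<le> x \<and> x \<le> y \<and> y \<le> b;
      disjoint_family_on (\<lambda>(x, y). {x<..<y}) D; (\<Sum>(x, y)\<in>D. y - x) < \<delta>\<rbrakk>
      \<Longrightarrow> (\<Sum>(x, y)\<in>D. \<bar>F y - F x\<bar>) < \<epsilon>"
proof -
  from assms(1)[unfolded abs_continuous_def, THEN spec[of _ a], THEN spec[of _ b], THEN spec[of _ \<epsilon>],
      THEN mp[OF _ assms(2)]]
  obtain \<delta> where "\<delta> > 0" and
    *: "\<forall>D :: (real \<times> real) set.
       finite D \<and> (\<forall>(x, y)\<in>D. a \<le> x \<and> x \<le> y \<and> y \<le> b) \<and>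
       disjoint_family_on (\<lambda>(x, y). {x<..<y}) D \<and> (\<Sum>(x, y)\<in>D. y - x) < \<delta>
       \<longrightarrow> (\<Sum>(x, y)\<in>D. \<bar>F y - F x\<bar>) < \<epsilon>"
    by (elim exE conjE)
  show thesis
    by (rule that[OF \<open>\<delta> > 0\<close>], rule *[THEN spec, THEN mp]) (simp add: Ball_def split_beta)
qed

lemma abs_continuous_isCont:
  assumes "abs_continuous F"
  shows "isCont F x"
  unfolding continuous_at_eps_delta
proof (intro allI impI)
  fix e :: real assume "e > 0"
  obtain d where "d > 0" and d: "\<And>D. \<lbrakk>finite D; \<And>y z. (y, z) \<in> D \<Longrightarrow> x - 1 \<le> y \<and> y \<le> z \<and> z \<le> x + 1;
      disjoint_family_on (\<lambda>(x, y). {x<..<y}) D; (\<Sum>(x, y)\<in>D. y - x) < d\<rbrakk>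
      \<Longrightarrow> (\<Sum>(x, y)\<in>D. \<bar>F y - F x\<bar>) < e"
    using abs_continuousE[OF assms \<open>e > 0\<close>, of "x - 1" "x + 1"] by metis
  have "dist (F x') (F x) < e" if "dist x' x < min d 1" for x'
  proof (cases "x \<le> x'")
    case True
    then show ?thesis
      using d[of "{(x, x')}"] that by (simp add: dist_real_def disjoint_family_on_def)
  next
    case False
    then show ?thesis
      using d[of "{(x', x)}"] that by (simp add: dist_real_def disjoint_family_on_def)
  qed
  then show "\<exists>d>0. \<forall>x'. dist x' x < d \<longrightarrow> dist (F x') (F x) < e"
    using \<open>d > 0\<close> by (intro exI[of _ "min d 1"]) auto
qed

lemma abs_continuous_uminus: "abs_continuous F \<Longrightarrow> abs_continuous (\<lambda>x. - F x)"
  unfolding abs_continuous_def by (simp add: abs_minus_commute)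

section \<open>Null sets and Lusin's property\<close>

text \<open>Translates measure into the length condition of \<open>abs_continuous\<close>:
  nonoverlapping intervals inside a set of measure below \<delta> form an admissible family.\<close>

lemma sum_disjoint_intervals_le:
  fixes D :: "(real \<times> real) set"
  assumes "finite D" "disjoint_family_on (\<lambda>(x, y). {x<..<y}) D"
    and D: "\<And>x y. (x, y) \<in> D \<Longrightarrow> x \<le> y \<and> {x<..<y} \<subseteq> U"
    and U: "U \<in> lmeasurable"
  shows "(\<Sum>(x, y)\<in>D. y - x) \<le> measure lebesgue U"
proof -
  have le: "fst i \<le> snd i" and sub: "{fst i<..<snd i} \<subseteq> U" if "i \<in> D" for i
    using D[of "fst i" "snd i"] that by auto
  have "(\<Sum>(x, y)\<in>D. y - x) = (\<Sum>i\<in>D. measure lebesgue {fst i<..<snd i})"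
    using le by (intro sum.cong) (auto simp: split_beta)
  also have "\<dots> = measure lebesgue (\<Union>i\<in>D. {fst i<..<snd i})"
    by (rule measure_finite_Union[symmetric])
       (use assms(1,2) le in \<open>auto simp: emeasure_lborel_Ioo split_beta'\<close>)
  also have "\<dots> \<le> measure lebesgue U"
    using sub U \<open>finite D\<close> by (intro measure_mono_fmeasurable sets.finite_UN UN_least) auto
  finally show ?thesis .
qed

lemma negligible_outer_open:
  assumes N: "negligible N" and "d > 0"
  obtains U where "open U" "N \<subseteq> U" "U \<in> lmeasurable" "measure lebesgue U < d"
proof -
  obtain U where U: "open U" "N \<subseteq> U" "(U - N) \<in> lmeasurable" "emeasure lebesgue (U - N) < ennreal d"
    using sets_lebesgue_outer_open[OF negligible_imp_sets[OF N] \<open>d > 0\<close>] by metis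
  have neg: "negligible ((U - N - U) \<union> (U - (U - N)))"
    using N by (rule negligible_subset) auto
  have "U \<in> lmeasurable"
    by (rule lmeasurable_negligible_symdiff[OF U(3) neg])
  moreover have "measure lebesgue U = measure lebesgue (U - N)"
    by (rule measure_negligible_symdiff[OF U(3) neg])
  moreover have "measure lebesgue (U - N) < d"
    using U(3,4) \<open>d > 0\<close> by (metis emeasure_eq_measure2 ennreal_less_iff measure_nonneg)
  ultimately show thesis using U(1,2) that by simp
qed

text \<open>Nonoverlapping intervals inside an open set of small measure cover the bounded part of
  \<open>N\<close>. By monotonicity the image of each lies in an interval whose length is the
  increment of \<open>h\<close>. Absolute continuity bounds the sum of increments over every finite
  subfamily, hence the measure of the countable union.\<close>

lemma negligible_image_abs_continuous:
  fixes h :: "real \<Rightarrow> real"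
  assumes mono: "mono h" and ac: "abs_continuous h" and N: "negligible N"
  shows "negligible (h ` N)"
proof -
  have bounded: "negligible (h ` (N \<inter> {a..b}))" if ab: "a < b" for a b
    unfolding negligible_outer_le
  proof (intro allI impI)
    fix e :: real assume e: "e > 0"
    obtain d where "d > 0" and d: "\<And>D. \<lbrakk>finite D; \<And>y z. (y, z) \<in> D \<Longrightarrow> a \<le> y \<and> y \<le> z \<and> z \<le> b;
      disjoint_family_on (\<lambda>(x, y). {x<..<y}) D; (\<Sum>(x, y)\<in>D. y - x) < d\<rbrakk>
      \<Longrightarrow> (\<Sum>(x, y)\<in>D. \<bar>h y - h x\<bar>) < e"
      using abs_continuousE[OF ac e, of a b] by metis
    obtain U where U: "open U" "N \<subseteq> U" and Um: "U \<in> lmeasurable" "measure lebesgue U < d"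
      using negligible_outer_open[OF N \<open>d > 0\<close>] by metis
    \<comment> \<open>Every covering interval has a tag in \<open>N\<close>, where the gauge is
      \<open>U\<close>, and so lies in \<open>U\<close>; \<open>UNIV\<close> is the default that
      makes the gauge contain x elsewhere.\<close>
    have gauge: "gauge (\<lambda>x. if x \<in> U then U else UNIV)"
      using \<open>open U\<close> by (auto simp: gauge_def)
    obtain \<D> where \<D>: "countable \<D>" "\<Union>\<D> \<subseteq> cbox a b"
      "\<And>K. K \<in> \<D> \<Longrightarrow> interior K \<noteq> {} \<and> (\<exists>c d. K = cbox c d)"
      "pairwise (\<lambda>A B. interior A \<inter> interior B = {}) \<D>"
      "\<And>K. K \<in> \<D> \<Longrightarrow> \<exists>x \<in> N \<inter> {a..b} \<inter> K. K \<subseteq> (if x \<in> U then U else UNIV)"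
      "N \<inter> {a..b} \<subseteq> \<Union>\<D>"
      by (rule covering_lemma[OF _ _ gauge, of "N \<inter> {a..b}" a b]) (use ab in auto)
    have "\<exists>c d. K = {c..d} \<and> c < d \<and> a \<le> c \<and> d \<le> b \<and> K \<subseteq> U" if KD: "K \<in> \<D>" for K
    proof -
      obtain c d where cd: "K = {c..d}" using \<D>(3)[OF KD] by auto
      moreover have "c < d" using \<D>(3)[OF KD] cd by auto
      moreover have "K \<subseteq> {a..b}" using \<D>(2) KD by (simp add: Sup_le_iff)
      moreover have "K \<subseteq> U" using \<D>(5)[OF KD] U(2) by (auto simp: subset_iff)
      ultimately show ?thesis by auto
    qed
    then obtain l u where K: "\<And>K. K \<in> \<D> \<Longrightarrow> K = {l K..u K} \<and> l K < u K \<and> a \<le> l K \<and> u K \<le> b \<and> K \<subseteq> U"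
      by metis
    let ?T = "\<Union>K\<in>\<D>. {h (l K)..h (u K)}"
    have fin: "measure lebesgue (\<Union>K\<in>F. {h (l K)..h (u K)}) \<le> e" if F: "F \<subseteq> \<D>" "finite F" for F
    proof -
      let ?p = "\<lambda>K. (l K, u K)"
      have KF: "K = {l K..u K}" "l K < u K" "a \<le> l K" "u K \<le> b" "{l K..u K} \<subseteq> U" if "K \<in> F" for K
        using K[of K] that F(1) by auto
      have inj: "inj_on ?p F"
      proof (rule inj_onI)
        fix K L assume KL: "K \<in> F" "L \<in> F" "(l K, u K) = (l L, u L)"
        have "K = {l K..u K}" by (rule KF(1)) fact
        also have "\<dots> = {l L..u L}" using KL(3) by simp
        also have "\<dots> = L" by (rule KF(1)[symmetric]) fact
        finally show "K = L" .
      qed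
      have disj: "disjoint_family_on (\<lambda>(x, y). {x<..<y}) (?p ` F)"
      proof -
        have "{l K<..<u K} \<inter> {l L<..<u L} = {}" if KL: "K \<in> F" "L \<in> F" "K \<noteq> L" for K L
        proof -
          have "interior K \<inter> interior L = {}"
            using \<D>(4) F KL unfolding pairwise_def by blast
          moreover have "interior K = {l K<..<u K}"
            using arg_cong[OF KF(1)[OF KL(1)], of interior] by (simp only: interior_atLeastAtMost_real)
          moreover have "interior L = {l L<..<u L}"
            using arg_cong[OF KF(1)[OF KL(2)], of interior] by (simp only: interior_atLeastAtMost_real)
          ultimately show ?thesis by simp
        qed
        then show ?thesis
          unfolding disjoint_family_on_def by fastforce
      qed
      have "(\<Sum>(x, y)\<in>?p ` F. y - x) \<le> measure lebesgue U"
      proof (rule sum_disjoint_intervals_le[OF _ disj _ Um(1)])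
        fix x y assume "(x, y) \<in> ?p ` F"
        then obtain K where xy: "K \<in> F" "x = l K" "y = u K" by auto
        show "x \<le> y \<and> {x<..<y} \<subseteq> U"
          using KF(2,5)[OF xy(1)] xy(2,3) greaterThanLessThan_subseteq_atLeastAtMost_iff[of x y x y] by auto
      qed (use F in auto)
      with Um(2) have small: "(\<Sum>(x, y)\<in>?p ` F. \<bar>h y - h x\<bar>) < e"
        by (intro d) (use F disj KF(2-4) in \<open>auto intro: less_imp_le\<close>)
      have "measure lebesgue (\<Union>K\<in>F. {h (l K)..h (u K)}) \<le> (\<Sum>K\<in>F. measure lebesgue {h (l K)..h (u K)})"
        by (rule measure_UNION_le) (use F in auto)
      also have "\<dots> = (\<Sum>(x, y)\<in>?p ` F. \<bar>h y - h x\<bar>)"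
        using monoD[OF mono] KF(2) by (subst sum.reindex[OF inj]) (auto intro!: sum.cong simp: less_imp_le)
      finally show ?thesis using small by simp
    qed
    show "\<exists>T. h ` (N \<inter> {a..b}) \<subseteq> T \<and> T \<in> lmeasurable \<and> measure lebesgue T \<le> e"
    proof (intro exI conjI)
      show "h ` (N \<inter> {a..b}) \<subseteq> ?T"
      proof
        fix y assume "y \<in> h ` (N \<inter> {a..b})"
        then obtain x where x: "x \<in> N \<inter> {a..b}" "y = h x" by auto
        then obtain K where "K \<in> \<D>" "x \<in> K" using \<D>(6) by blast
        then have "l K \<le> x \<and> x \<le> u K" using K[of K] by auto
        then show "y \<in> ?T"
          using \<open>K \<in> \<D>\<close> monoD[OF mono] x(2) by (intro UN_I[of K]) auto
      qed
      show "?T \<in> lmeasurable"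
        by (rule fmeasurable_UN_bound[OF \<D>(1) _ fin]) auto
      show "measure lebesgue ?T \<le> e"
        by (rule measure_UN_bound[OF \<D>(1) _ fin]) auto
    qed
  qed
  \<comment> \<open>Absolute continuity is uniform only on compact intervals. \<open>Suc n\<close>
    keeps the endpoints distinct at n = 0, as \<open>bounded\<close> requires.\<close>
  have "h ` N = (\<Union>n::nat. h ` (N \<inter> {- real (Suc n)..real (Suc n)}))"
  proof -
    have "\<exists>n::nat. - real (Suc n) \<le> x \<and> x \<le> real (Suc n)" for x :: real
    proof -
      obtain n :: nat where "\<bar>x\<bar> \<le> real n" using real_arch_simple by blast
      then show ?thesis by (intro exI[of _ n]) auto
    qed
    then show ?thesis by fastforce
  qed
  also have "negligible \<dots>"
    by (rule negligible_countable_Union) (auto intro: bounded)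
  finally show ?thesis .
qed

section \<open>Vitali coverings and the outer measure of images\<close>

text \<open>Vitali's theorem for balls, with an interval seen as the ball about its midpoint: it has
  to contain x but not to be centred there. Intervals are coded as pairs of endpoints.\<close>

lemma Vitali_covering_intervals:
  fixes E :: "real set"
  assumes cov: "\<And>x e. x \<in> E \<Longrightarrow> e > 0 \<Longrightarrow> \<exists>c d. P c d \<and> c \<le> x \<and> x \<le> d \<and> c < d \<and> d - c < e"
  obtains C where "countable C" "\<forall>i\<in>C. P (fst i) (snd i) \<and> fst i < snd i"
    "disjoint_family_on (\<lambda>i. {fst i..snd i}) C"
    "negligible (E - (\<Union>i\<in>C. {fst i..snd i}))"
proof -
  let ?K = "{i. P (fst i) (snd i) \<and> fst i < snd i}"
  let ?a = "\<lambda>i. (fst i + snd i) / 2" and ?r = "\<lambda>i. (snd i - fst i) / 2"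
  have cball: "cball (?a i) (?r i) = {fst i..snd i}" for i :: "real \<times> real"
    by (auto simp: cball_eq_atLeastAtMost field_simps)
  obtain C where C: "countable C" "C \<subseteq> ?K"
     "pairwise (\<lambda>i j. disjnt (cball (?a i) (?r i)) (cball (?a j) (?r j))) C"
     "negligible (E - (\<Union>i\<in>C. cball (?a i) (?r i)))"
  proof (rule Vitali_covering_theorem_cballs[of ?K ?r E ?a])
    fix x d assume "x \<in> E" "0 < (d::real)"
    then obtain c b where "P c b" "c \<le> x" "x \<le> b" "c < b" "b - c < d"
      using cov by metis
    then show "\<exists>i. i \<in> ?K \<and> x \<in> cball (?a i) (?r i) \<and> ?r i < d"
      unfolding cball by (intro exI[of _ "(c, b)"]) auto
  qed auto
  show thesis
  proof
    show "countable C" "negligible (E - (\<Union>i\<in>C. {fst i..snd i}))"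
      using C by (simp_all only: cball)
    show "\<forall>i\<in>C. P (fst i) (snd i) \<and> fst i < snd i" using C(2) by auto
    show "disjoint_family_on (\<lambda>i. {fst i..snd i}) C"
      using C(3) unfolding cball disjoint_family_on_def pairwise_def disjnt_def by blast
  qed
qed

text \<open>The image intervals are open because \<open>h\<close> may be constant between two
  disjoint intervals, and then the closed images share an endpoint.\<close>

lemma disjoint_family_mono_image:
  fixes h :: "real \<Rightarrow> real"
  assumes mono: "mono h" and disj: "disjoint_family_on (\<lambda>i. {fst i..snd i}) C"
    and less: "\<And>i. i \<in> C \<Longrightarrow> fst i < snd i"
  shows "disjoint_family_on (\<lambda>i. {h (fst i)<..<h (snd i)}) C"
  unfolding disjoint_family_on_def
proof (intro ballI impI)
  fix i j assume ij: "i \<in> C" "j \<in> C" "i \<noteq> j"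
  then have "{fst i..snd i} \<inter> {fst j..snd j} = {}"
    using disj by (auto simp: disjoint_family_on_def)
  then have "snd i < fst j \<or> snd j < fst i"
    using less[OF ij(1)] less[OF ij(2)]
    by (metis Int_iff atLeastAtMost_iff empty_iff linorder_le_cases linorder_not_less less_imp_le)
  then have "h (snd i) \<le> h (fst j) \<or> h (snd j) \<le> h (fst i)"
    using monoD[OF mono] by (auto intro: less_imp_le)
  then show "{h (fst i)<..<h (snd i)} \<inter> {h (fst j)<..<h (snd j)} = {}" by auto
qed

text \<open>Vitali intervals of slope at most \<open>s\<close> cover \<open>E\<close> up to a null
  set. Their images, each at most \<open>s\<close> times as long, cover the image of
  \<open>E\<close> up to countably many endpoint values and, by Lusin's property, a null
  set.\<close>

lemma outer_measure_of_image_le: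
  fixes h :: "real \<Rightarrow> real"
  assumes mono: "mono h" and ac: "abs_continuous h" and s: "s \<ge> 0"
    and E: "\<And>x e. x \<in> E \<Longrightarrow> e > 0 \<Longrightarrow>
      \<exists>c d. h d - h c \<le> s * (d - c) \<and> c \<le> x \<and> x \<le> d \<and> c < d \<and> d - c < e"
  shows "outer_measure_of lebesgue (h ` E) \<le> s * outer_measure_of lebesgue E"
proof -
  \<comment> \<open>Choosing the intervals inside \<open>U\<close> bounds their total length by the
    measure of \<open>U\<close>, which is afterwards shrunk onto a measurable hull of
    \<open>E\<close>.\<close>
  have openU: "outer_measure_of lebesgue (h ` E) \<le> s * emeasure lebesgue U" if U: "open U" "E \<subseteq> U" for U
  proof -
    have "\<exists>c d. (h d - h c \<le> s * (d - c) \<and> {c..d} \<subseteq> U) \<and> c \<le> x \<and> x \<le> d \<and> c < d \<and> d - c < e"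
      if xe: "x \<in> E" "e > 0" for x e
    proof -
      obtain r where r: "r > 0" "ball x r \<subseteq> U" using U xe by (meson openE subsetD)
      obtain c d where cd: "h d - h c \<le> s * (d - c)" "c \<le> x" "x \<le> d" "c < d" "d - c < min e r"
        using E[OF xe(1), of "min e r"] xe r by auto
      have "{c..d} \<subseteq> ball x r" using cd by (auto simp: dist_real_def)
      with cd r show ?thesis by (intro exI[of _ c] exI[of _ d]) auto
    qed
    then obtain C where C: "countable C" "\<forall>i\<in>C. (h (snd i) - h (fst i) \<le> s * (snd i - fst i) \<and> {fst i..snd i} \<subseteq> U) \<and> fst i < snd i"
      "disjoint_family_on (\<lambda>i. {fst i..snd i}) C" "negligible (E - (\<Union>i\<in>C. {fst i..snd i}))"
      by (rule Vitali_covering_intervals[of E "\<lambda>c d. h d - h c \<le> s * (d - c) \<and> {c..d} \<subseteq> U"])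
    let ?N = "E - (\<Union>i\<in>C. {fst i..snd i})"
    have C': "h (snd i) - h (fst i) \<le> s * (snd i - fst i)" "{fst i..snd i} \<subseteq> U" "fst i < snd i" if "i \<in> C" for i
      using C(2) that by auto
    let ?V = "\<Union>i\<in>C. {h (fst i)<..<h (snd i)}"
    let ?Z = "h ` (fst ` C) \<union> h ` (snd ` C) \<union> h ` ?N"
    have Z: "?Z \<in> null_sets lebesgue"
      using C(1) negligible_image_abs_continuous[OF mono ac C(4)]
      unfolding negligible_iff_null_sets
      by (intro null_sets.Un) (auto intro!: null_sets_completionI countable_imp_null_set_lborel)
    have sub: "h ` E \<subseteq> ?V \<union> ?Z"
    proof
      fix y assume "y \<in> h ` E"
      then obtain x where x: "x \<in> E" "y = h x" by auto
      show "y \<in> ?V \<union> ?Z"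
      proof (cases "x \<in> ?N")
        case False
        then obtain i where i: "i \<in> C" "fst i \<le> x" "x \<le> snd i" using x by auto
        then have "h (fst i) \<le> y" "y \<le> h (snd i)" using monoD[OF mono] x by auto
        then have "y = h (fst i) \<or> y = h (snd i) \<or> h (fst i) < y \<and> y < h (snd i)" by auto
        with i(1) show ?thesis by (auto intro: imageI)
      qed (use x in auto)
    qed
    have disj: "disjoint_family_on (\<lambda>i. {h (fst i)<..<h (snd i)}) C"
      using mono C(3) C'(3) by (rule disjoint_family_mono_image)
    have V: "?V \<in> sets lebesgue"
      using C(1) by auto
    have "outer_measure_of lebesgue (h ` E) \<le> outer_measure_of lebesgue (?V \<union> ?Z)"
      by (rule outer_measure_of_mono[OF sub])
    also have "\<dots> = emeasure lebesgue (?V \<union> ?Z)"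
      by (rule outer_measure_of_eq[OF sets.Un[OF V null_setsD2[OF Z]]])
    also have "\<dots> = emeasure lebesgue ?V"
      by (rule emeasure_Un_null_set[OF V Z])
    also have "\<dots> = (\<integral>\<^sup>+i. emeasure lebesgue {h (fst i)<..<h (snd i)} \<partial>count_space C)"
      by (rule emeasure_UN_countable) (use C(1) disj in auto)
    also have "\<dots> \<le> (\<integral>\<^sup>+i. s * emeasure lebesgue {fst i..snd i} \<partial>count_space C)"
    proof (rule nn_integral_mono)
      fix i assume "i \<in> space (count_space C)"
      then have i: "i \<in> C" by simp
      have "h (fst i) \<le> h (snd i)" using C'(3)[OF i] monoD[OF mono] by auto
      then show "emeasure lebesgue {h (fst i)<..<h (snd i)} \<le> s * emeasure lebesgue {fst i..snd i}"
        using C'[OF i] s by (simp add: emeasure_lborel_Ioo emeasure_lborel_Icc ennreal_mult[symmetric] ennreal_leI)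
    qed
    also have "\<dots> = s * (\<integral>\<^sup>+i. emeasure lebesgue {fst i..snd i} \<partial>count_space C)"
      by (rule nn_integral_cmult) auto
    also have "(\<integral>\<^sup>+i. emeasure lebesgue {fst i..snd i} \<partial>count_space C) = emeasure lebesgue (\<Union>i\<in>C. {fst i..snd i})"
      by (rule emeasure_UN_countable[symmetric]) (use C(1,3) in auto)
    also have "s * emeasure lebesgue (\<Union>i\<in>C. {fst i..snd i}) \<le> s * emeasure lebesgue U"
      using C'(2) U by (intro mult_left_mono emeasure_mono UN_least) auto
    finally show ?thesis .
  qed
  obtain S where S: "S \<in> sets lebesgue" "E \<subseteq> S" "outer_measure_of lebesgue E = emeasure lebesgue S"
    using outer_measure_of_attain[of E lebesgue] by auto
  have "outer_measure_of lebesgue (h ` E) \<le> s * outer_measure_of lebesgue E + ennreal e" if e: "e > 0" for e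
  proof -
    \<comment> \<open>The denominator s + 1 keeps the error s e / (s + 1) below e and is positive
      even for s = 0.\<close>
    obtain U where U: "open U" "S \<subseteq> U" "U - S \<in> lmeasurable" "emeasure lebesgue (U - S) < ennreal (e / (s + 1))"
      using sets_lebesgue_outer_open[OF S(1), of "e / (s + 1)"] e s by auto
    have "outer_measure_of lebesgue (h ` E) \<le> s * emeasure lebesgue U"
      using U S by (intro openU) auto
    also have "emeasure lebesgue U \<le> emeasure lebesgue S + emeasure lebesgue (U - S)"
      using emeasure_subadditive[of S lebesgue "U - S"] U S by (simp add: fmeasurableD Un_absorb1 fmeasurableD)
    also have "\<dots> \<le> emeasure lebesgue S + ennreal (e / (s + 1))"
      using U by (intro add_left_mono) auto
    also have "s * \<dots> = s * emeasure lebesgue S + ennreal (s * (e / (s + 1)))"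
      unfolding distrib_left using s e by (subst ennreal_mult) auto
    also have "\<dots> \<le> s * emeasure lebesgue S + ennreal e"
      using s e by (intro add_left_mono ennreal_leI) (simp add: field_simps)
    finally show ?thesis using S by (simp add: mult_left_mono)
  qed
  then show ?thesis
    by (rule ennreal_le_epsilon) 
qed

text \<open>Here the open set surrounds the image, and continuity of \<open>h\<close> keeps the
  images of short intervals inside it. These images are disjoint and at least \<open>r\<close> times
  as long as the intervals, whose union covers \<open>E\<close> up to a null set.\<close>

lemma outer_measure_of_image_ge:
  fixes h :: "real \<Rightarrow> real"
  assumes mono: "mono h" and ac: "abs_continuous h" and r: "r \<ge> 0"
    and E: "\<And>x e. x \<in> E \<Longrightarrow> e > 0 \<Longrightarrow>
      \<exists>c d. h d - h c \<ge> r * (d - c) \<and> c \<le> x \<and> x \<le> d \<and> c < d \<and> d - c < e"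
  shows "r * outer_measure_of lebesgue E \<le> outer_measure_of lebesgue (h ` E)"
proof -
  have openU: "r * outer_measure_of lebesgue E \<le> emeasure lebesgue U" if U: "open U" "h ` E \<subseteq> U" for U
  proof -
    have "\<exists>c d. (h d - h c \<ge> r * (d - c) \<and> {h c<..<h d} \<subseteq> U) \<and> c \<le> x \<and> x \<le> d \<and> c < d \<and> d - c < e"
      if xe: "x \<in> E" "e > 0" for x e
    proof -
      obtain q where q: "q > 0" "ball (h x) q \<subseteq> U" using U xe by (meson openE subsetD imageI)
      obtain p where p: "p > 0" "\<And>y. dist y x < p \<Longrightarrow> dist (h y) (h x) < q"
        using abs_continuous_isCont[OF ac, of x] q unfolding continuous_at_eps_delta by blast
      obtain c d where cd: "h d - h c \<ge> r * (d - c)" "c \<le> x" "x \<le> d" "c < d" "d - c < min e p"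
        using E[OF xe(1), of "min e p"] xe p by auto
      have "{h c<..<h d} \<subseteq> ball (h x) q"
        using cd p(2)[of c] p(2)[of d] by (auto simp: dist_real_def)
      with cd q show ?thesis by (intro exI[of _ c] exI[of _ d]) auto
    qed
    then obtain C where C: "countable C" "\<forall>i\<in>C. (h (snd i) - h (fst i) \<ge> r * (snd i - fst i) \<and> {h (fst i)<..<h (snd i)} \<subseteq> U) \<and> fst i < snd i"
      "disjoint_family_on (\<lambda>i. {fst i..snd i}) C" "negligible (E - (\<Union>i\<in>C. {fst i..snd i}))"
      by (rule Vitali_covering_intervals[of E "\<lambda>c d. h d - h c \<ge> r * (d - c) \<and> {h c<..<h d} \<subseteq> U"])
    let ?N = "E - (\<Union>i\<in>C. {fst i..snd i})"
    have C': "h (snd i) - h (fst i) \<ge> r * (snd i - fst i)" "{h (fst i)<..<h (snd i)} \<subseteq> U" "fst i < snd i" if "i \<in> C" for i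
      using C(2) that by auto
    have disj: "disjoint_family_on (\<lambda>i. {h (fst i)<..<h (snd i)}) C"
      using mono C(3) C'(3) by (rule disjoint_family_mono_image)
    have N: "?N \<in> null_sets lebesgue" using C(4) by (simp add: negligible_iff_null_sets)
    have CU: "(\<Union>i\<in>C. {fst i..snd i}) \<in> sets lebesgue"
      using C(1) by auto
    have "outer_measure_of lebesgue E \<le> outer_measure_of lebesgue ((\<Union>i\<in>C. {fst i..snd i}) \<union> ?N)"
      by (rule outer_measure_of_mono) auto
    also have "\<dots> = emeasure lebesgue ((\<Union>i\<in>C. {fst i..snd i}) \<union> ?N)"
      by (rule outer_measure_of_eq[OF sets.Un[OF CU null_setsD2[OF N]]])
    also have "\<dots> = emeasure lebesgue (\<Union>i\<in>C. {fst i..snd i})"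
      by (rule emeasure_Un_null_set[OF CU N])
    also have "\<dots> = (\<integral>\<^sup>+i. emeasure lebesgue {fst i..snd i} \<partial>count_space C)"
      by (rule emeasure_UN_countable) (use C(1,3) in auto)
    finally have "r * outer_measure_of lebesgue E \<le> r * (\<integral>\<^sup>+i. emeasure lebesgue {fst i..snd i} \<partial>count_space C)"
      by (rule mult_left_mono) simp
    also have "\<dots> = (\<integral>\<^sup>+i. r * emeasure lebesgue {fst i..snd i} \<partial>count_space C)"
      by (rule nn_integral_cmult[symmetric]) auto
    also have "\<dots> \<le> (\<integral>\<^sup>+i. emeasure lebesgue {h (fst i)<..<h (snd i)} \<partial>count_space C)"
    proof (rule nn_integral_mono)
      fix i assume "i \<in> space (count_space C)"
      then have i: "i \<in> C" by simp
      have "h (fst i) \<le> h (snd i)" using C'(3)[OF i] monoD[OF mono] by auto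
      then show "r * emeasure lebesgue {fst i..snd i} \<le> emeasure lebesgue {h (fst i)<..<h (snd i)}"
        using C'[OF i] r by (simp add: emeasure_lborel_Ioo emeasure_lborel_Icc ennreal_mult[symmetric] ennreal_leI)
    qed
    also have "\<dots> = emeasure lebesgue (\<Union>i\<in>C. {h (fst i)<..<h (snd i)})"
      by (rule emeasure_UN_countable[symmetric]) (use C(1) disj in auto)
    also have "\<dots> \<le> emeasure lebesgue U"
      using C'(2) U by (intro emeasure_mono UN_least) auto
    finally show ?thesis .
  qed
  obtain S where S: "S \<in> sets lebesgue" "h ` E \<subseteq> S" "outer_measure_of lebesgue (h ` E) = emeasure lebesgue S"
    using outer_measure_of_attain[of "h ` E" lebesgue] by auto
  have "r * outer_measure_of lebesgue E \<le> outer_measure_of lebesgue (h ` E) + ennreal e" if e: "e > 0" for e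
  proof -
    obtain U where U: "open U" "S \<subseteq> U" "U - S \<in> lmeasurable" "emeasure lebesgue (U - S) < ennreal e"
      using sets_lebesgue_outer_open[OF S(1) e] by auto
    have "r * outer_measure_of lebesgue E \<le> emeasure lebesgue U"
      using U S by (intro openU) auto
    also have "emeasure lebesgue U \<le> emeasure lebesgue S + emeasure lebesgue (U - S)"
      using emeasure_subadditive[of S lebesgue "U - S"] U S by (simp add: fmeasurableD Un_absorb1 fmeasurableD)
    also have "\<dots> \<le> emeasure lebesgue S + ennreal e"
      using U by (intro add_left_mono) auto
    finally show ?thesis using S by simp
  qed
  then show ?thesis
    by (rule ennreal_le_epsilon)
qed

section \<open>Derivatives from the slopes of short intervals\<close>

text \<open>An interval with endpoint x is among those containing x, so the bounds apply to the
  difference quotients on both sides.\<close>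

lemma straddle_imp_DERIV:
  fixes h :: "real \<Rightarrow> real"
  assumes D: "\<And>e. e > 0 \<Longrightarrow> \<exists>p>0. \<forall>c d. c \<le> x \<and> x \<le> d \<and> c < d \<and> d - c < p \<longrightarrow>
      (D - e) * (d - c) \<le> h d - h c \<and> h d - h c \<le> (D + e) * (d - c)"
  shows "(h has_real_derivative D) (at x)"
  unfolding has_field_derivative_iff LIM_def
proof (intro allI impI)
  fix e :: real assume e: "e > 0"
  obtain p where p: "p > 0" "\<And>c d. c \<le> x \<Longrightarrow> x \<le> d \<Longrightarrow> c < d \<Longrightarrow> d - c < p \<Longrightarrow>
      (D - e/2) * (d - c) \<le> h d - h c \<and> h d - h c \<le> (D + e/2) * (d - c)"
    using D[of "e/2"] e by auto
  have "dist ((h y - h x) / (y - x)) D < e" if y: "y \<noteq> x" "dist y x < p" for y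
  proof -
    have "D - e/2 \<le> (h y - h x) / (y - x) \<and> (h y - h x) / (y - x) \<le> D + e/2"
    proof (cases "x < y")
      case True
      then show ?thesis using p(2)[of x y] y by (simp add: dist_real_def field_simps)
    next
      case False
      have eq: "(h y - h x) / (y - x) = (h x - h y) / (x - y)"
        using y(1) by (simp add: field_simps)
      show ?thesis unfolding eq
        using False p(2)[of y x] y by (simp add: dist_real_def field_simps)
    qed
    then show ?thesis using e by (auto simp: dist_real_def abs_less_iff)
  qed
  then show "\<exists>s>0. \<forall>xa. xa \<noteq> x \<and> dist xa x < s \<longrightarrow> dist ((h xa - h x) / (xa - x)) D < e"
    using p(1) by (intro exI[of _ p]) auto
qed

text \<open>Up to equality at the boundary value, this says that the lower derivate of
  \<open>h\<close> over shrinking intervals around x is at most s. The form is the covering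
  condition of the first image estimate; \<open>slope_ge\<close> is the counterpart for the upper
  derivate.\<close>

definition slope_le :: "(real \<Rightarrow> real) \<Rightarrow> real \<Rightarrow> real \<Rightarrow> bool" where
  "slope_le h s x \<longleftrightarrow> (\<forall>e>0. \<exists>c d. h d - h c \<le> s * (d - c) \<and> c \<le> x \<and> x \<le> d \<and> c < d \<and> d - c < e)"

definition slope_ge :: "(real \<Rightarrow> real) \<Rightarrow> real \<Rightarrow> real \<Rightarrow> bool" where
  "slope_ge h r x \<longleftrightarrow> (\<forall>e>0. \<exists>c d. h d - h c \<ge> r * (d - c) \<and> c \<le> x \<and> x \<le> d \<and> c < d \<and> d - c < e)"

text \<open>A point can fail to have a positive derivative in three ways: unbounded slopes, slopes
  not bounded away from zero, or a gap between lower and upper derivate. The gap is witnessed by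
  rationals so that only countably many cases arise.\<close>

lemma DERIV_from_slopes:
  fixes h :: "real \<Rightarrow> real"
  assumes bdd: "\<not> slope_ge h R x" and pos: "s0 > 0" "\<not> slope_le h s0 x"
    and gap: "\<And>s r. s \<in> \<rat> \<Longrightarrow> r \<in> \<rat> \<Longrightarrow> 0 < s \<Longrightarrow> s < r \<Longrightarrow> \<not> (slope_le h s x \<and> slope_ge h r x)"
  shows "\<exists>D>0. (h has_real_derivative D) (at x)"
proof -
  let ?S = "{s. \<not> slope_le h s x}"
  have R: "slope_le h R x"
    unfolding slope_le_def
  proof (intro allI impI)
    fix e :: real assume "e > 0"
    obtain p where p: "p > 0" "\<And>c d. c \<le> x \<Longrightarrow> x \<le> d \<Longrightarrow> c < d \<Longrightarrow> d - c < p \<Longrightarrow> h d - h c < R * (d - c)"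
      using bdd unfolding slope_ge_def by (meson linorder_not_less)
    have "x - 0 \<le> x \<and> x \<le> x + min p e / 2 \<and> x < x + min p e / 2 \<and> (x + min p e / 2) - x < p \<and> (x + min p e / 2) - x < e"
      using \<open>e > 0\<close> p(1) by (auto simp: min_def)
    then show "\<exists>c d. h d - h c \<le> R * (d - c) \<and> c \<le> x \<and> x \<le> d \<and> c < d \<and> d - c < e"
      using p(2)[of x "x + min p e / 2"] by (intro exI[of _ x] exI[of _ "x + min p e / 2"]) auto
  qed
  have slope_mono: "slope_le h s' x" if s: "slope_le h s x" "s \<le> s'" for s s'
    unfolding slope_le_def
  proof (intro allI impI)
    fix e :: real assume "e > 0"
    then obtain c d where cd: "h d - h c \<le> s * (d - c)" "c \<le> x" "x \<le> d" "c < d" "d - c < e"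
      using s(1) unfolding slope_le_def by blast
    moreover have "s * (d - c) \<le> s' * (d - c)" using s(2) cd by (intro mult_right_mono) auto
    ultimately show "\<exists>c d. h d - h c \<le> s' * (d - c) \<and> c \<le> x \<and> x \<le> d \<and> c < d \<and> d - c < e"
      by (meson order_trans)
  qed
  have ub: "s \<le> R" if "s \<in> ?S" for s using slope_mono[OF R, of s] that by fastforce
  have bddS: "bdd_above ?S" using ub by (rule bdd_aboveI)
  \<comment> \<open>\<open>D\<close> is the lower derivate, the supremum of the slopes exceeded by
    all short intervals around x; \<open>R\<close> makes it finite and \<open>s0\<close> makes it
    positive.\<close>
  define D where "D = Sup ?S"
  have "s0 \<le> D" unfolding D_def using pos bddS by (intro cSup_upper) auto
  with pos have "D > 0" by simp
  moreover have "(h has_real_derivative D) (at x)"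
  proof (rule straddle_imp_DERIV)
    fix e :: real assume e: "e > 0"
    obtain s where s: "s \<in> ?S" "D - e < s"
      using less_cSup_iff[OF _ bddS, of "D - e"] e pos unfolding D_def by auto
    obtain p where p: "p > 0" "\<And>c d. c \<le> x \<Longrightarrow> x \<le> d \<Longrightarrow> c < d \<Longrightarrow> d - c < p \<Longrightarrow> s * (d - c) < h d - h c"
      using s(1) unfolding slope_le_def mem_Collect_eq by (meson linorder_not_less)
    \<comment> \<open>Since \<open>u\<close> lies above \<open>D\<close>, arbitrarily short
      intervals have slope at most \<open>u\<close>. The gap hypothesis then keeps the slopes of all
      short intervals below \<open>r\<close>, hence below \<open>D + e\<close>.\<close>
    obtain u where u: "u \<in> \<rat>" "D < u" "u < D + e" using Rats_dense_in_real[of D "D + e"] e by auto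
    obtain r where r: "r \<in> \<rat>" "u < r" "r < D + e" using Rats_dense_in_real[of u "D + e"] u by auto
    have "slope_le h u x"
      using cSup_upper[OF _ bddS, of u] u(2) unfolding D_def by fastforce
    with gap[OF u(1) r(1)] u r \<open>D > 0\<close> have "\<not> slope_ge h r x" by auto
    then obtain q where q: "q > 0" "\<And>c d. c \<le> x \<Longrightarrow> x \<le> d \<Longrightarrow> c < d \<Longrightarrow> d - c < q \<Longrightarrow> h d - h c < r * (d - c)"
      unfolding slope_ge_def by (meson linorder_not_less)
    show "\<exists>p>0. \<forall>c d. c \<le> x \<and> x \<le> d \<and> c < d \<and> d - c < p \<longrightarrow>
      (D - e) * (d - c) \<le> h d - h c \<and> h d - h c \<le> (D + e) * (d - c)"
    proof (intro exI[of _ "min p q"] conjI allI impI)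
      show "0 < min p q" using p q by simp
      fix c d assume cd: "c \<le> x \<and> x \<le> d \<and> c < d \<and> d - c < min p q"
      have "(D - e) * (d - c) \<le> s * (d - c)" "r * (d - c) \<le> (D + e) * (d - c)"
        using s r cd by (simp_all add: mult_right_mono)
      moreover have "s * (d - c) < h d - h c" "h d - h c < r * (d - c)"
        using p(2)[of c d] q(2)[of c d] cd by simp_all
      ultimately show "(D - e) * (d - c) \<le> h d - h c" "h d - h c \<le> (D + e) * (d - c)"
        by linarith+
    qed
  qed
  ultimately show ?thesis by auto
qed

lemma negligible_iff_outer_measure_of:
  "negligible E \<longleftrightarrow> outer_measure_of lebesgue E = 0"
proof
  assume "negligible E"
  then show "outer_measure_of lebesgue E = 0"
    by (metis negligible_iff_null_sets null_setsD1 null_setsD2 outer_measure_of_eq)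
next
  assume "outer_measure_of lebesgue E = 0"
  then show "negligible E"
    using outer_measure_of_attain[of E lebesgue]
    by (metis negligible_iff_emeasure0 negligible_subset top_greatest space_borel space_completion space_lborel)
qed

lemma outer_measure_of_bounded_finite:
  fixes E :: "real set"
  assumes "E \<subseteq> {a..b}"
  shows "outer_measure_of lebesgue E < \<infinity>"
proof -
  have "outer_measure_of lebesgue E \<le> outer_measure_of lebesgue {a..b}"
    by (rule outer_measure_of_mono[OF assms])
  also have "\<dots> < \<infinity>"
    by (simp add: emeasure_lborel_Icc_eq)
  finally show ?thesis .
qed

text \<open>Each kind of bad point is treated on bounded pieces E. Slopes near zero: the image has
  measure at most s |E| for every s > 0. Unbounded slopes: r |E| is at most the finite measure of
  the image for every r > 0, so E is null. A gap s < r: r |E| <= s |E| with |E| finite, so E is null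
  again. Null pieces have null images by Lusin's property.\<close>

proposition negligible_image_no_pos_derivative:
  fixes h :: "real \<Rightarrow> real"
  assumes mono: "mono h" and ac: "abs_continuous h"
  shows "negligible (h ` {x. \<not> (\<exists>D>0. (h has_real_derivative D) (at x))})"
proof -
  have le: "outer_measure_of lebesgue (h ` E) \<le> s * outer_measure_of lebesgue E"
    if "s > 0" "\<And>x. x \<in> E \<Longrightarrow> slope_le h s x" for s E
    using that unfolding slope_le_def by (intro outer_measure_of_image_le[OF mono ac]) auto
  have ge: "r * outer_measure_of lebesgue E \<le> outer_measure_of lebesgue (h ` E)"
    if "r > 0" "\<And>x. x \<in> E \<Longrightarrow> slope_ge h r x" for r E
    using that unfolding slope_ge_def by (intro outer_measure_of_image_ge[OF mono ac]) auto
  have neg0: "negligible (h ` (E \<inter> {- real n..real n}))"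
    if E: "\<And>x s. x \<in> E \<Longrightarrow> s > 0 \<Longrightarrow> slope_le h s x" for E and n :: nat
  proof -
    let ?E = "E \<inter> {- real n..real n}"
    have fin: "outer_measure_of lebesgue ?E < \<infinity>"
      by (rule outer_measure_of_bounded_finite[of _ "- real n" "real n"]) auto
    then obtain m where m: "m \<ge> 0" "outer_measure_of lebesgue ?E = ennreal m"
      by (cases "outer_measure_of lebesgue ?E") auto
    have "outer_measure_of lebesgue (h ` ?E) \<le> 0 + ennreal e" if e: "e > 0" for e
    proof -
      have "outer_measure_of lebesgue (h ` ?E) \<le> ennreal (e / (m + 1)) * ennreal m"
        using le[of "e / (m + 1)" ?E] E e m by auto
      also have "\<dots> \<le> ennreal e"
      proof -
        have "e / (m + 1) * m \<le> e" using e m by (simp add: field_simps)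
        then show ?thesis using e m by (simp only: ennreal_mult[symmetric] divide_nonneg_nonneg ennreal_leI)
      qed
      finally show ?thesis by simp
    qed
    then have "outer_measure_of lebesgue (h ` ?E) \<le> 0"
      by (rule ennreal_le_epsilon)
    then show ?thesis by (simp add: negligible_iff_outer_measure_of)
  qed
  have negInf: "negligible (h ` (E \<inter> {- real n..real n}))"
    if E: "\<And>x r. x \<in> E \<Longrightarrow> slope_ge h r x" for E and n :: nat
  proof -
    let ?E = "E \<inter> {- real n..real n}"
    have "outer_measure_of lebesgue (h ` ?E) < \<infinity>"
      by (rule outer_measure_of_bounded_finite[of _ "h (- real n)" "h (real n)"]) (use monoD[OF mono] in auto)
    then obtain m where m: "m \<ge> 0" "outer_measure_of lebesgue (h ` ?E) = ennreal m"
      by (cases "outer_measure_of lebesgue (h ` ?E)") auto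
    have "outer_measure_of lebesgue ?E \<le> 0 + ennreal e" if e: "e > 0" for e
    proof -
      \<comment> \<open>Chosen so that m / r <= e, where m is the outer measure of the image; adding
        1 keeps \<open>r\<close> positive for m = 0.\<close>
      define r where "r = (m + 1) / e"
      have r: "r > 0" "1 / r * m \<le> e" using e m by (simp_all add: r_def field_simps)
      have "ennreal (1 / r) * ennreal r = 1"
        using r(1) by (simp add: ennreal_mult[symmetric])
      then have "outer_measure_of lebesgue ?E = ennreal (1 / r) * (ennreal r * outer_measure_of lebesgue ?E)"
        by (simp add: mult.assoc[symmetric])
      also have "\<dots> \<le> ennreal (1 / r) * ennreal m"
        using ge[OF r(1), of ?E] E m by (intro mult_left_mono) auto
      also have "\<dots> \<le> ennreal e"
        using m r by (simp add: ennreal_mult[symmetric] ennreal_leI)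
      finally show ?thesis by simp
    qed
    then have "outer_measure_of lebesgue ?E \<le> 0"
      by (rule ennreal_le_epsilon)
    then have "negligible ?E" by (simp add: negligible_iff_outer_measure_of)
    then show ?thesis by (rule negligible_image_abs_continuous[OF mono ac])
  qed
  have neg_gap: "negligible (h ` (E \<inter> {- real n..real n}))"
    if E: "\<And>x. x \<in> E \<Longrightarrow> slope_le h s x \<and> slope_ge h r x" and sr: "0 < s" "s < r" for s r E and n :: nat
  proof -
    let ?E = "E \<inter> {- real n..real n}"
    have fin: "outer_measure_of lebesgue ?E < \<infinity>"
      by (rule outer_measure_of_bounded_finite[of _ "- real n" "real n"]) auto
    then obtain m where m: "m \<ge> 0" "outer_measure_of lebesgue ?E = ennreal m"
      by (cases "outer_measure_of lebesgue ?E") auto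
    have "ennreal (r * m) \<le> outer_measure_of lebesgue (h ` ?E)"
      using ge[of r ?E] E sr m by (auto simp: ennreal_mult)
    also have "\<dots> \<le> ennreal (s * m)"
      using le[of s ?E] E sr m by (auto simp: ennreal_mult)
    finally have "r * m \<le> s * m" using sr m by simp
    then have "m = 0" using sr m by (metis less_le mult_right_cancel mult_right_mono order_antisym less_imp_le)
    then have "negligible ?E" using m by (simp add: negligible_iff_outer_measure_of)
    then show ?thesis by (rule negligible_image_abs_continuous[OF mono ac])
  qed
  let ?Q = "{q \<in> \<rat> \<times> \<rat>. 0 < fst q \<and> fst q < (snd q :: real)}"
  let ?I = "\<lambda>n::nat. {- real n..real n}"
  let ?A = "{x. \<forall>s>0. slope_le h s x}" and ?B = "{x. \<forall>r. slope_ge h r x}"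
    and ?G = "\<lambda>q. {x. slope_le h (fst q) x \<and> slope_ge h (snd q) x}"
  have "countable ?Q"
    by (rule countable_subset[of _ "\<rat> \<times> \<rat>"]) (auto simp: countable_rat)
  then have "negligible (\<Union>q\<in>?Q. \<Union>n. h ` (?G q \<inter> ?I n))"
    by (intro negligible_countable_Union countable_image) (auto intro!: negligible_countable_Union neg_gap)
  moreover have "negligible (\<Union>n. h ` (?A \<inter> ?I n))" "negligible (\<Union>n. h ` (?B \<inter> ?I n))"
    by (rule negligible_countable_Union, simp, use neg0[of ?A] in auto)
       (rule negligible_countable_Union, simp, use negInf[of ?B] in auto)
  ultimately have "negligible ((\<Union>n. h ` (?A \<inter> ?I n)) \<union> (\<Union>n. h ` (?B \<inter> ?I n)) \<union> (\<Union>q\<in>?Q. \<Union>n. h ` (?G q \<inter> ?I n)))"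
    by (intro negligible_Un)
  then show ?thesis
  proof (rule negligible_subset)
    show "h ` {x. \<not> (\<exists>D>0. (h has_real_derivative D) (at x))}
      \<subseteq> (\<Union>n. h ` (?A \<inter> ?I n)) \<union> (\<Union>n. h ` (?B \<inter> ?I n)) \<union> (\<Union>q\<in>?Q. \<Union>n. h ` (?G q \<inter> ?I n))"
    proof
      fix y assume "y \<in> h ` {x. \<not> (\<exists>D>0. (h has_real_derivative D) (at x))}"
      then obtain x where x: "y = h x" "\<not> (\<exists>D>0. (h has_real_derivative D) (at x))" by auto
      obtain n :: nat where "\<bar>x\<bar> \<le> real n"
        using real_arch_simple by blast
      then have n: "x \<in> ?I n" by auto
      consider "x \<in> ?A" | "x \<in> ?B" | s r where "(s, r) \<in> ?Q" "x \<in> ?G (s, r)"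
      proof -
        assume 1: "x \<in> ?A \<Longrightarrow> thesis" and 2: "x \<in> ?B \<Longrightarrow> thesis"
          and 3: "\<And>s r. (s, r) \<in> ?Q \<Longrightarrow> x \<in> ?G (s, r) \<Longrightarrow> thesis"
        show thesis
        proof (rule ccontr)
          assume nt: "\<not> thesis"
          then obtain R s0 where "\<not> slope_ge h R x" "s0 > 0" "\<not> slope_le h s0 x"
            using 1 2 by auto
          moreover have "\<not> (slope_le h s x \<and> slope_ge h r x)" if "s \<in> \<rat>" "r \<in> \<rat>" "0 < s" "s < r" for s r
            using 3[of s r] that nt by auto
          ultimately show False using DERIV_from_slopes[of h R x s0] x(2) by blast
        qed
      qed
      then show "y \<in> (\<Union>n. h ` (?A \<inter> ?I n)) \<union> (\<Union>n. h ` (?B \<inter> ?I n)) \<union> (\<Union>q\<in>?Q. \<Union>n. h ` (?G q \<inter> ?I n))"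
      proof cases
        case 1
        with n have "y \<in> h ` (?A \<inter> ?I n)" using x(1) by (intro image_eqI IntI)
        then show ?thesis by (rule UnI1[OF UnI1[OF UN_I[OF UNIV_I]]])
      next
        case 2
        with n have "y \<in> h ` (?B \<inter> ?I n)" using x(1) by (intro image_eqI IntI)
        then show ?thesis by (rule UnI1[OF UnI2[OF UN_I[OF UNIV_I]]])
      next
        case (3 s r)
        with n have "y \<in> h ` (?G (s, r) \<inter> ?I n)" using x(1) by (intro image_eqI IntI)
        then show ?thesis by (intro UnI2 UN_I[OF 3(1)]) (rule UN_I[OF UNIV_I])
      qed
    qed
  qed
qed

section \<open>Fundamental theorem of calculus for absolutely continuous functions\<close>

text \<open>The gauge integral yields existence and value together, without prior integrability of
  \<open>f\<close>. At tags off \<open>N\<close> the definition of the derivative controls the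
  error; tags in \<open>N\<close> are confined to an open set so small that absolute continuity
  bounds the increments there.\<close>

lemma has_integral_abs_continuous_derivative:
  fixes F :: "real \<Rightarrow> real"
  assumes ac: "abs_continuous F" and ab: "a \<le> b" and N: "negligible N"
    and der: "\<And>x. x \<in> {a..b} - N \<Longrightarrow> (F has_real_derivative f x) (at x)"
  shows "(f has_integral (F b - F a)) {a..b}"
proof -
  \<comment> \<open>With the value 0 on \<open>N\<close>, a tag in \<open>N\<close> contributes only
    the increment of \<open>F\<close> to the error.\<close>
  define f' where "f' = (\<lambda>x. if x \<in> N then 0 else f x)"
  have "(f' has_integral (F b - F a)) (cbox a b)"
    unfolding has_integral
  proof (intro allI impI)
    fix e :: real assume e: "e > 0"
    \<comment> \<open>The total error off \<open>N\<close> is at most q (b - a); adding 1 keeps the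
      denominator positive when a = b.\<close>
    define q where "q = e / (2 * (b - a + 1))"
    have q: "q > 0" "q * (b - a) < e / 2" using e ab by (auto simp: q_def field_simps)
    have "\<exists>d>0. \<forall>y. \<bar>y - x\<bar> < d \<longrightarrow> \<bar>F y - F x - f x * (y - x)\<bar> \<le> q * \<bar>y - x\<bar>" if "x \<in> {a..b} - N" for x
      using der[OF that, unfolded has_field_derivative_def has_derivative_at_alt] q(1) by auto
    then obtain d where d: "\<And>x. x \<in> {a..b} - N \<Longrightarrow> d x > 0"
      "\<And>x y. x \<in> {a..b} - N \<Longrightarrow> \<bar>y - x\<bar> < d x \<Longrightarrow> \<bar>F y - F x - f x * (y - x)\<bar> \<le> q * \<bar>y - x\<bar>"
      by metis
    obtain \<delta> where "\<delta> > 0" and \<delta>: "\<And>D. \<lbrakk>finite D; \<And>y z. (y, z) \<in> D \<Longrightarrow> a \<le> y \<and> y \<le> z \<and> z \<le> b;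
      disjoint_family_on (\<lambda>(x, y). {x<..<y}) D; (\<Sum>(x, y)\<in>D. y - x) < \<delta>\<rbrakk>
      \<Longrightarrow> (\<Sum>(x, y)\<in>D. \<bar>F y - F x\<bar>) < e / 2"
      using abs_continuousE[OF ac, of "e / 2" a b] e by (metis half_gt_zero)
    obtain U where U: "open U" "N \<subseteq> U" "U \<in> lmeasurable" "measure lebesgue U < \<delta>"
      using negligible_outer_open[OF N \<open>\<delta> > 0\<close>] by metis
    define \<gamma> where "\<gamma> x = (if x \<in> N then U else if x \<in> {a..b} then ball x (d x) else UNIV)" for x
    have gauge: "gauge \<gamma>"
      using U d(1) by (auto simp: gauge_def \<gamma>_def)
    have fine: "norm ((\<Sum>(x, K)\<in>p. measure lborel K *\<^sub>R f' x) - (F b - F a)) < e"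
      if p: "p tagged_division_of cbox a b" "\<gamma> fine p" for p
    proof -
      note finp = tagged_division_of_finite[OF p(1)]
      let ?N = "{i \<in> p. fst i \<in> N}"
      have K: "\<exists>c d. K = {c..d} \<and> c \<le> x \<and> x \<le> d \<and> a \<le> c \<and> d \<le> b \<and> {c..d} \<subseteq> \<gamma> x" if xK: "(x, K) \<in> p" for x K
      proof -
        obtain c d where "K = cbox c d" using tagged_division_ofD(4)[OF p(1) xK] by blast
        moreover have "x \<in> K" "K \<subseteq> cbox a b" using tagged_division_ofD(2,3)[OF p(1) xK] by auto
        moreover have "K \<subseteq> \<gamma> x" using p(2) xK by (auto simp: fine_def)
        ultimately show ?thesis by auto
      qed
      define L where "L i = Inf (snd i)" for i :: "real \<times> real set"
      define R where "R i = Sup (snd i)" for i :: "real \<times> real set"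
      have LR: "snd i = {L i..R i}" "L i \<le> fst i" "fst i \<le> R i" "a \<le> L i" "R i \<le> b" "{L i..R i} \<subseteq> \<gamma> (fst i)"
        if i: "i \<in> p" for i
        using K[of "fst i" "snd i"] i by (auto simp: L_def R_def)
      have le: "L i \<le> R i" if "i \<in> p" for i using LR(2,3)[OF that] by simp
      have int: "interior (snd i) = {L i<..<R i}" if "i \<in> p" for i
        using arg_cong[OF LR(1)[OF that], of interior] by (simp only: interior_atLeastAtMost_real)
      have content: "measure lborel (snd i) = R i - L i" if "i \<in> p" for i
        using arg_cong[OF LR(1)[OF that], of "measure lborel"] LR(2,3)[OF that] by simp
      have disj: "{L i<..<R i} \<inter> {L j<..<R j} = {}" if "i \<in> p" "j \<in> p" "i \<noteq> j" for i j
        using tagged_division_ofD(5)[OF p(1), of "fst i" "snd i" "fst j" "snd j"] that int by auto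
      have tel: "b - a = (\<Sum>i\<in>p. R i - L i)" "F b - F a = (\<Sum>i\<in>p. F (R i) - F (L i))"
        using additive_tagged_division_1[OF ab, of p "\<lambda>x. x"] additive_tagged_division_1[OF ab, of p F] p(1)
        by (auto simp: L_def R_def split_beta)
      let ?D = "(\<lambda>i. (L i, R i)) ` ?N"
      \<comment> \<open>Distinct tagged intervals can share both endpoints only when they are
        degenerate, and then the increment is zero.\<close>
      have reindex: "(\<Sum>(x, y)\<in>?D. \<bar>F y - F x\<bar>) = (\<Sum>i\<in>?N. \<bar>F (R i) - F (L i)\<bar>)"
      proof (subst sum.reindex_nontrivial)
        fix i j assume ij: "i \<in> ?N" "j \<in> ?N" "i \<noteq> j" "(L i, R i) = (L j, R j)"
        then have "{L i<..<R i} = {}" using disj[of i j] by auto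
        then have "L i = R i" using LR(2,3)[of i] ij(1) by auto
        then show "(case (L i, R i) of (x, y) \<Rightarrow> \<bar>F y - F x\<bar>) = 0" by simp
      qed (use finp in auto)
      have disjD: "disjoint_family_on (\<lambda>(x, y). {x<..<y}) ?D"
        unfolding disjoint_family_on_def using disj by fastforce
      have "(\<Sum>(x, y)\<in>?D. y - x) \<le> measure lebesgue U"
      proof (rule sum_disjoint_intervals_le[OF _ disjD _ U(3)])
        fix x y assume "(x, y) \<in> ?D"
        then obtain i where i: "i \<in> p" "fst i \<in> N" "x = L i" "y = R i" by auto
        then have "{x..y} \<subseteq> U" "x \<le> y" using LR(2,3,6)[of i] by (auto simp: \<gamma>_def)
        then show "x \<le> y \<and> {x<..<y} \<subseteq> U"
          by (auto simp: subset_iff)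
      qed (use finp in auto)
      with U(4) have "(\<Sum>(x, y)\<in>?D. \<bar>F y - F x\<bar>) < e / 2"
        by (intro \<delta>[OF _ _ disjD]) (use finp LR(4,5) le in auto)
      then have bad: "\<bar>\<Sum>i\<in>?N. measure lborel (snd i) * f' (fst i) - (F (R i) - F (L i))\<bar> < e / 2"
        unfolding reindex by (intro le_less_trans[OF sum_abs]) (simp add: f'_def abs_minus_commute)
      have "\<bar>measure lborel (snd i) * f' (fst i) - (F (R i) - F (L i))\<bar> \<le> q * (R i - L i)" if i: "i \<in> p - ?N" for i
      proof -
        let ?x = "fst i"
        have x: "?x \<in> {a..b} - N" using i LR(2-5)[of i] by auto
        have sub: "{L i..R i} \<subseteq> ball ?x (d ?x)" using LR(6)[of i] i x by (auto simp: \<gamma>_def split: if_splits)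
        have "L i \<in> ball ?x (d ?x)" "R i \<in> ball ?x (d ?x)"
          by (rule subsetD[OF sub], use le[of i] i in simp)+
        then have "\<bar>F (R i) - F ?x - f ?x * (R i - ?x)\<bar> \<le> q * (R i - ?x)"
          "\<bar>F (L i) - F ?x - f ?x * (L i - ?x)\<bar> \<le> q * (?x - L i)"
          using d(2)[OF x, of "L i"] d(2)[OF x, of "R i"] LR(2,3)[of i] i
          by (auto simp: dist_real_def abs_minus_commute)
        moreover have "measure lborel (snd i) * f' ?x - (F (R i) - F (L i))
            = (F (L i) - F ?x - f ?x * (L i - ?x)) - (F (R i) - F ?x - f ?x * (R i - ?x))"
        proof -
          have "measure lborel (snd i) = R i - L i" "f' ?x = f ?x" using content[of i] i x by (simp_all add: f'_def)
          then show ?thesis by (simp only:) (simp add: algebra_simps)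
        qed
        ultimately have "\<bar>measure lborel (snd i) * f' ?x - (F (R i) - F (L i))\<bar> \<le> q * (?x - L i) + q * (R i - ?x)"
          by linarith
        then show ?thesis by (simp add: algebra_simps)
      qed
      then have "\<bar>\<Sum>i\<in>p - ?N. measure lborel (snd i) * f' (fst i) - (F (R i) - F (L i))\<bar> \<le> (\<Sum>i\<in>p - ?N. q * (R i - L i))"
        by (intro order_trans[OF sum_abs] sum_mono)
      also have "\<dots> \<le> (\<Sum>i\<in>p. q * (R i - L i))"
        using finp q(1) le by (intro sum_mono2) (auto intro!: mult_nonneg_nonneg)
      also have "\<dots> = q * (b - a)" by (simp add: tel(1) sum_distrib_left)
      finally have good: "\<bar>\<Sum>i\<in>p - ?N. measure lborel (snd i) * f' (fst i) - (F (R i) - F (L i))\<bar> < e / 2"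
        using q(2) by simp
      have "(\<Sum>(x, K)\<in>p. measure lborel K *\<^sub>R f' x) - (F b - F a) = (\<Sum>i\<in>p. measure lborel (snd i) * f' (fst i) - (F (R i) - F (L i)))"
        by (simp add: tel(2) sum_subtractf split_beta)
      also have "\<dots> = (\<Sum>i\<in>p - ?N. measure lborel (snd i) * f' (fst i) - (F (R i) - F (L i)))
          + (\<Sum>i\<in>?N. measure lborel (snd i) * f' (fst i) - (F (R i) - F (L i)))"
        by (rule sum.subset_diff) (use finp in auto)
      finally show ?thesis using good bad unfolding real_norm_def by linarith
    qed
    show "\<exists>\<gamma>. gauge \<gamma> \<and> (\<forall>\<D>. \<D> tagged_division_of cbox a b \<and> \<gamma> fine \<D> \<longrightarrow>
        norm ((\<Sum>(x, K)\<in>\<D>. measure lborel K *\<^sub>R f' x) - (F b - F a)) < e)"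
      by (intro exI[of _ \<gamma>] conjI allI impI gauge) (elim conjE, rule fine)
  qed
  then show ?thesis
    by (intro has_integral_spike[OF N, of _ f f']) (auto simp: f'_def)
qed

section \<open>Bowl-shaped loss functions\<close>

text \<open>Expresses the derivative as a limit along one fixed sequence; such a limit is a Borel
  function of x even if some points have no derivative.\<close>

lemma has_real_derivative_lim:
  assumes "(F has_real_derivative D) (at x)"
  shows "lim (\<lambda>n. (F (x + 1 / real (Suc n)) - F x) * real (Suc n)) = D"
proof -
  have "(\<lambda>n. 1 / real (Suc n)) \<longlonglongrightarrow> 0"
    using LIMSEQ_inverse_real_of_nat by (simp add: inverse_eq_divide)
  then have "filterlim (\<lambda>n. 1 / real (Suc n)) (at 0) sequentially"
    by (simp add: filterlim_at)
  moreover have "((\<lambda>h. (F (x + h) - F x) / h) \<longlongrightarrow> D) (at 0)"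
    using assms by (simp add: DERIV_def)
  ultimately have "(\<lambda>n. (F (x + 1 / real (Suc n)) - F x) / (1 / real (Suc n))) \<longlonglongrightarrow> D"
    by (rule filterlim_compose[rotated])
  then show ?thesis by (intro limI) simp
qed

text \<open>A Borel version \<open>r\<close> of the derivative of \<open>\<rho>\<close>, in a form of the fundamental theorem of calculus
  that avoids subtracting possibly infinite integrals.\<close>

lemma strictly_bowl_shaped_derivative:
  assumes "strictly_bowl_shaped \<rho>"
  obtains r where "r \<in> borel_measurable borel" "AE x in lborel. (\<rho> has_real_derivative r x) (at x)"
    "\<forall>a b. a \<le> b \<longrightarrow> ennreal (\<rho> b) + (\<integral>\<^sup>+x. ennreal (- r x) * indicator {a..b} x \<partial>lborel)
      = ennreal (\<rho> a) + (\<integral>\<^sup>+x. ennreal (r x) * indicator {a..b} x \<partial>lborel)"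
    "\<forall>a b. a \<le> b \<longrightarrow> (\<integral>\<^sup>+x. ennreal (- r x) * indicator {a..b} x \<partial>lborel) \<le> ennreal (\<rho> a)"
proof -
  have ac: "abs_continuous \<rho>" and zero: "\<rho> 0 = 0" and nn: "\<rho> t \<ge> 0" for t
    using assms by (auto simp: strictly_bowl_shaped_def)
  have cont: "continuous_on UNIV \<rho>"
    using abs_continuous_isCont[OF ac] by (simp add: continuous_at_imp_continuous_on)
  define r where "r x = lim (\<lambda>n. (\<rho> (x + 1 / real (Suc n)) - \<rho> x) * real (Suc n))" for x
  have [measurable]: "\<rho> \<in> borel_measurable borel"
    using cont by (rule borel_measurable_continuous_onI)
  have meas[measurable]: "r \<in> borel_measurable borel"
    unfolding r_def by measurable
  define good where "good x \<longleftrightarrow> (\<rho> has_real_derivative r x) (at x) \<and> (x < 0 \<longrightarrow> r x < 0) \<and> (x > 0 \<longrightarrow> r x > 0)" for x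
  have "AE x in lborel. x \<noteq> (0::real)" by (rule AE_lborel_singleton)
  moreover have "AE t in lborel. t < 0 \<longrightarrow> (\<exists>D<0. (\<rho> has_real_derivative D) (at t))"
    "AE t in lborel. t > 0 \<longrightarrow> (\<exists>D>0. (\<rho> has_real_derivative D) (at t))"
    using assms by (auto simp: strictly_bowl_shaped_def)
  ultimately have "AE x in lborel. good x"
  proof eventually_elim
    case (elim x)
    obtain D where "(\<rho> has_real_derivative D) (at x)" "x < 0 \<longrightarrow> D < 0" "x > 0 \<longrightarrow> D > 0"
    proof (cases "x < 0")
      case True
      then show ?thesis using elim(2) that by auto
    next
      case False
      then have "x > 0" using elim(1) by auto
      then show ?thesis using elim(3) that by auto
    qed
    moreover from this(1) have "r x = D" unfolding r_def by (rule has_real_derivative_lim)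
    ultimately show "good x" by (simp add: good_def)
  qed
  note good = this
  obtain N where N: "N \<in> null_sets lborel" "\<And>x. x \<notin> N \<Longrightarrow> good x"
    using AE_E3[OF good] by auto
  have negN: "negligible (insert 0 N)"
    using null_sets_completionI[OF N(1)] by (simp flip: negligible_iff_null_sets)
  have AE0: "AE x in lborel. x \<noteq> (0::real)" by (rule AE_lborel_singleton)
  \<comment> \<open>On the interval, \<open>max 0\<close> changes the integrand only on a null set
    and makes it nonnegative everywhere, so the gauge integral can be read as a nonnegative Lebesgue
    integral.\<close>
  have has_int_pos: "((\<lambda>x. max 0 (r x)) has_integral \<rho> b - \<rho> a) {a..b}" if ab: "0 \<le> a" "a \<le> b" for a b
  proof (rule has_integral_abs_continuous_derivative[OF ac ab(2) negN])
    fix x assume "x \<in> {a..b} - insert 0 N"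
    then have "good x" "x > 0" using N(2) ab by auto
    then show "(\<rho> has_real_derivative max 0 (r x)) (at x)"
      unfolding good_def by (metis less_imp_le max.absorb2)
  qed
  have has_int_neg: "((\<lambda>x. max 0 (- r x)) has_integral (- \<rho> b) - (- \<rho> a)) {a..b}" if ab: "a \<le> b" "b \<le> 0" for a b
  proof (rule has_integral_abs_continuous_derivative[OF abs_continuous_uminus[OF ac] ab(1) negN])
    fix x assume "x \<in> {a..b} - insert 0 N"
    then have "good x" "x < 0" using N(2) ab by auto
    then show "((\<lambda>x. - \<rho> x) has_real_derivative max 0 (- r x)) (at x)"
      unfolding good_def by (metis DERIV_minus less_imp_le max.absorb2 neg_0_le_iff_le)
  qed
  have mono_pos: "\<rho> a \<le> \<rho> b" if "0 \<le> a" "a \<le> b" for a b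
    using has_integral_nonneg[OF has_int_pos[OF that]] by simp
  have mono_neg: "\<rho> b \<le> \<rho> a" if "a \<le> b" "b \<le> 0" for a b
    using has_integral_nonneg[OF has_int_neg[OF that]] by simp
  have pos: "(\<integral>\<^sup>+x. ennreal (r x) * indicator {a..b} x \<partial>lborel) = ennreal (\<rho> b - \<rho> a)"
    "(\<integral>\<^sup>+x. ennreal (- r x) * indicator {a..b} x \<partial>lborel) = 0" if ab: "0 \<le> a" "a \<le> b" for a b
  proof -
    note has_int_pos[OF ab]
    then have "(\<integral>\<^sup>+x. ennreal (indicator {a..b} x * max 0 (r x)) \<partial>lborel) = ennreal (\<rho> b - \<rho> a)"
      by (intro nn_integral_has_integral_lebesgue) auto
    also have "(\<lambda>x. ennreal (indicator {a..b} x * max 0 (r x))) = (\<lambda>x. ennreal (r x) * indicator {a..b} x)"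
      by (auto simp: fun_eq_iff indicator_def max_def ennreal_neg)
    finally show "(\<integral>\<^sup>+x. ennreal (r x) * indicator {a..b} x \<partial>lborel) = ennreal (\<rho> b - \<rho> a)" .
    have "(\<integral>\<^sup>+x. ennreal (- r x) * indicator {a..b} x \<partial>lborel) = (\<integral>\<^sup>+(x::real). 0 \<partial>lborel)"
    proof (rule nn_integral_cong_AE)
      show "AE x in lborel. ennreal (- r x) * indicator {a..b} x = 0"
        using good AE0 by eventually_elim (use ab in \<open>auto simp: good_def ennreal_neg indicator_def\<close>)
    qed
    then show "(\<integral>\<^sup>+x. ennreal (- r x) * indicator {a..b} x \<partial>lborel) = 0" by simp
  qed
  have neg: "(\<integral>\<^sup>+x. ennreal (- r x) * indicator {a..b} x \<partial>lborel) = ennreal (\<rho> a - \<rho> b)"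
    "(\<integral>\<^sup>+x. ennreal (r x) * indicator {a..b} x \<partial>lborel) = 0" if ab: "a \<le> b" "b \<le> 0" for a b
  proof -
    note has_int_neg[OF ab]
    then have "(\<integral>\<^sup>+x. ennreal (indicator {a..b} x * max 0 (- r x)) \<partial>lborel) = ennreal ((- \<rho> b) - (- \<rho> a))"
      by (intro nn_integral_has_integral_lebesgue) auto
    also have "(\<lambda>x. ennreal (indicator {a..b} x * max 0 (- r x))) = (\<lambda>x. ennreal (- r x) * indicator {a..b} x)"
      by (auto simp: fun_eq_iff indicator_def max_def ennreal_neg)
    finally show "(\<integral>\<^sup>+x. ennreal (- r x) * indicator {a..b} x \<partial>lborel) = ennreal (\<rho> a - \<rho> b)" by simp
    have "(\<integral>\<^sup>+x. ennreal (r x) * indicator {a..b} x \<partial>lborel) = (\<integral>\<^sup>+(x::real). 0 \<partial>lborel)"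
    proof (rule nn_integral_cong_AE)
      show "AE x in lborel. ennreal (r x) * indicator {a..b} x = 0"
        using good AE0 by eventually_elim (use ab in \<open>auto simp: good_def ennreal_neg indicator_def\<close>)
    qed
    then show "(\<integral>\<^sup>+x. ennreal (r x) * indicator {a..b} x \<partial>lborel) = 0" by simp
  qed
  \<comment> \<open>The point 0 belongs to both halves, so the integrands agree only almost
    everywhere.\<close>
  have split: "(\<integral>\<^sup>+x. f x * indicator {a..b} x \<partial>lborel)
      = (\<integral>\<^sup>+x. f x * indicator {a..0} x \<partial>lborel) + (\<integral>\<^sup>+x. f x * indicator {0..b} x \<partial>lborel)"
    if "a \<le> 0" "0 \<le> b" and [measurable]: "f \<in> borel_measurable borel" for a b :: real and f :: "real \<Rightarrow> ennreal"
  proof -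
    have "(\<integral>\<^sup>+x. f x * indicator {a..b} x \<partial>lborel) = (\<integral>\<^sup>+x. f x * indicator {a..0} x + f x * indicator {0..b} x \<partial>lborel)"
      by (intro nn_integral_cong_AE, use AE0 in eventually_elim) (use that in \<open>auto simp: indicator_def\<close>)
    also have "\<dots> = (\<integral>\<^sup>+x. f x * indicator {a..0} x \<partial>lborel) + (\<integral>\<^sup>+x. f x * indicator {0..b} x \<partial>lborel)"
      by (rule nn_integral_add) auto
    finally show ?thesis .
  qed
  show thesis
  proof (rule that[OF meas])
    show "AE x in lborel. (\<rho> has_real_derivative r x) (at x)"
      using good by eventually_elim (simp add: good_def)
  next
    show "\<forall>a b. a \<le> b \<longrightarrow> ennreal (\<rho> b) + (\<integral>\<^sup>+x. ennreal (- r x) * indicator {a..b} x \<partial>lborel)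
      = ennreal (\<rho> a) + (\<integral>\<^sup>+x. ennreal (r x) * indicator {a..b} x \<partial>lborel)"
    proof (intro allI impI)
      fix a b :: real assume ab: "a \<le> b"
      consider "0 \<le> a" | "b \<le> 0" | "a \<le> 0" "0 \<le> b" by linarith
      then show "ennreal (\<rho> b) + (\<integral>\<^sup>+x. ennreal (- r x) * indicator {a..b} x \<partial>lborel)
        = ennreal (\<rho> a) + (\<integral>\<^sup>+x. ennreal (r x) * indicator {a..b} x \<partial>lborel)"
      proof cases
        case 1
        have "ennreal (\<rho> b) = ennreal (\<rho> a) + ennreal (\<rho> b - \<rho> a)"
          using mono_pos[OF 1 ab] nn by (subst ennreal_plus[symmetric]) auto
        then show ?thesis by (simp add: pos[OF 1 ab])
      next
        case 2
        have "ennreal (\<rho> a) = ennreal (\<rho> b) + ennreal (\<rho> a - \<rho> b)"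
          using mono_neg[OF ab 2] nn by (subst ennreal_plus[symmetric]) auto
        then show ?thesis by (simp add: neg[OF ab 2])
      next
        case 3
        have "(\<integral>\<^sup>+x. ennreal (- r x) * indicator {a..b} x \<partial>lborel) = ennreal (\<rho> a - \<rho> 0) + 0"
          unfolding neg(1)[OF 3(1) order_refl, symmetric] pos(2)[OF order_refl 3(2), symmetric]
          by (rule split[OF 3]) simp
        moreover have "(\<integral>\<^sup>+x. ennreal (r x) * indicator {a..b} x \<partial>lborel) = 0 + ennreal (\<rho> b - \<rho> 0)"
          unfolding neg(2)[OF 3(1) order_refl, symmetric] pos(1)[OF order_refl 3(2), symmetric]
          by (rule split[OF 3]) simp
        ultimately show ?thesis by (simp add: zero add.commute)
      qed
    qed
  next
    show "\<forall>a b. a \<le> b \<longrightarrow> (\<integral>\<^sup>+x. ennreal (- r x) * indicator {a..b} x \<partial>lborel) \<le> ennreal (\<rho> a)"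
    proof (intro allI impI)
      fix a b :: real assume ab: "a \<le> b"
      consider "0 \<le> a" | "b \<le> 0" | "a \<le> 0" "0 \<le> b" by linarith
      then show "(\<integral>\<^sup>+x. ennreal (- r x) * indicator {a..b} x \<partial>lborel) \<le> ennreal (\<rho> a)"
      proof cases
        case 1
        show ?thesis by (simp add: pos[OF 1 ab])
      next
        case 2
        show ?thesis using nn[of b] by (simp add: neg[OF ab 2] ennreal_leI)
      next
        case 3
        have "(\<integral>\<^sup>+x. ennreal (- r x) * indicator {a..b} x \<partial>lborel) = ennreal (\<rho> a - \<rho> 0) + 0"
          unfolding neg(1)[OF 3(1) order_refl, symmetric] pos(2)[OF order_refl 3(2), symmetric]
          by (rule split[OF 3]) simp
        then show ?thesis by (simp add: zero)
      qed
    qed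
  qed
qed

lemma derivative_mono_convex:
  fixes F :: "real \<Rightarrow> real"
  assumes conv: "convex_on UNIV F" and "x \<le> y"
    and "(F has_real_derivative D) (at x)" "(F has_real_derivative E) (at y)"
  shows "D \<le> E"
proof (cases "x = y")
  case True
  then show ?thesis using assms DERIV_unique by blast
next
  case False
  have "F y - F x \<ge> D * (y - x)" "F x - F y \<ge> E * (x - y)"
    using convex_on_imp_above_tangent[OF conv, of x y D] convex_on_imp_above_tangent[OF conv, of y x E] assms
    by auto
  then have "(E - D) * (y - x) \<ge> 0" by (simp add: algebra_simps)
  then show ?thesis using False assms(2) by (simp add: zero_le_mult_iff)
qed

text \<open>The derivative of \<open>\<rho>\<close> is exceptional on a null set of the line,
  whereas the score evaluates it at u + c v. For fixed v the bad u form a translate of a null set,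
  so the bad pairs are null by Tonelli.\<close>

lemma AE_lborel_shear:
  fixes P :: "real \<Rightarrow> bool"
  assumes "AE x in lborel. P x"
  shows "AE (u, v) in lborel. P (u + c * v)"
proof -
  obtain N where N: "N \<in> null_sets lborel" "\<And>x. x \<notin> N \<Longrightarrow> P x"
    using AE_E3[OF assms] by auto
  have [measurable]: "N \<in> sets borel" using N(1) by auto
  let ?M = "{z. fst z + c * snd z \<in> N}"
  have "(\<lambda>z. fst z + c * snd z) -` N \<inter> space (lborel \<Otimes>\<^sub>M lborel) \<in> sets (lborel \<Otimes>\<^sub>M lborel)"
    by measurable
  then have M[measurable]: "?M \<in> sets (lborel \<Otimes>\<^sub>M lborel)"
    by (simp add: space_pair_measure vimage_def)
  have "emeasure (lborel \<Otimes>\<^sub>M lborel) ?M = (\<integral>\<^sup>+v. emeasure lborel ((\<lambda>u. (u, v)) -` ?M) \<partial>lborel)"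
    by (rule lborel_pair.emeasure_pair_measure_alt2) measurable
  also have "\<dots> = (\<integral>\<^sup>+v. 0 \<partial>(lborel :: real measure))"
  proof (rule nn_integral_cong)
    fix v :: real
    have "emeasure lborel N = (\<integral>\<^sup>+x. indicator N x \<partial>lborel)" by simp
    also have "\<dots> = (\<integral>\<^sup>+x. indicator N (c * v + 1 * x) \<partial>lborel)"
      by (subst nn_integral_real_affine[where c = 1 and t = "c * v"]) auto
    also have "\<dots> = (\<integral>\<^sup>+x. indicator ((\<lambda>u. (u, v)) -` ?M) x \<partial>lborel)"
      by (rule nn_integral_cong) (auto simp: indicator_def add.commute)
    also have "\<dots> = emeasure lborel ((\<lambda>u. (u, v)) -` ?M)"
      by (rule nn_integral_indicator) (rule sets_Pair2, measurable)
    finally show "emeasure lborel ((\<lambda>u. (u, v)) -` ?M) = 0"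
      using N(1) by auto
  qed
  finally have "?M \<in> null_sets (lborel \<Otimes>\<^sub>M lborel)" using M by (intro null_setsI) simp_all
  then have "?M \<in> null_sets lborel" by (simp only: lborel_prod)
  then show ?thesis
  proof (rule AE_I')
    show "{z \<in> space lborel. \<not> (case z of (u, v) \<Rightarrow> P (u + c * v))} \<subseteq> ?M"
    proof -
      have "x \<in> N" if "\<not> P x" for x using N(2) that by blast
      then show ?thesis by auto
    qed
  qed
qed

section \<open>Risk differences\<close>

lemma nn_integral_lborel_affine_pair:
  fixes F :: "real \<times> real \<Rightarrow> ennreal"
  assumes [measurable]: "F \<in> borel_measurable borel" and s: "s > 0"
  shows "(\<integral>\<^sup>+z. F z \<partial>lborel) = ennreal (s\<^sup>2) * (\<integral>\<^sup>+z. F (m + s * fst z, s * snd z) \<partial>lborel)"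
proof -
  have F[measurable]: "F \<in> borel_measurable (lborel \<Otimes>\<^sub>M lborel)"
    by (simp add: lborel_prod)
  have "(\<integral>\<^sup>+z. F z \<partial>lborel) = (\<integral>\<^sup>+u. (\<integral>\<^sup>+v. F (u, v) \<partial>lborel) \<partial>lborel)"
    by (simp add: lborel.nn_integral_fst lborel_prod)
  also have "\<dots> = (\<integral>\<^sup>+u. ennreal s * (\<integral>\<^sup>+v. F (u, s * v) \<partial>lborel) \<partial>lborel)"
    using s by (intro nn_integral_cong) (subst nn_integral_real_affine[where c = s and t = 0], auto)
  also have "\<dots> = ennreal s * (\<integral>\<^sup>+u. (\<integral>\<^sup>+v. F (u, s * v) \<partial>lborel) \<partial>lborel)"
    by (rule nn_integral_cmult) measurable
  also have "(\<integral>\<^sup>+u. (\<integral>\<^sup>+v. F (u, s * v) \<partial>lborel) \<partial>lborel)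
      = ennreal s * (\<integral>\<^sup>+u. (\<integral>\<^sup>+v. F (m + s * u, s * v) \<partial>lborel) \<partial>lborel)"
    using s by (subst nn_integral_real_affine[where c = s and t = m]) auto
  also have "(\<integral>\<^sup>+u. (\<integral>\<^sup>+v. F (m + s * u, s * v) \<partial>lborel) \<partial>lborel)
      = (\<integral>\<^sup>+z. F (m + s * fst z, s * snd z) \<partial>(lborel \<Otimes>\<^sub>M lborel))"
    by (subst lborel.nn_integral_fst[symmetric]) auto
  finally show ?thesis
    using s by (simp add: lborel_prod mult.assoc[symmetric] ennreal_mult[symmetric] power2_eq_square)
qed

lemma joint_density_measurable:
  assumes "continuous_on {0<..} f" "s > 0"
  shows "(\<lambda>z. joint_density n f m s (fst z) (snd z)) \<in> borel_measurable (borel \<Otimes>\<^sub>M borel)"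
proof -
  \<comment> \<open>\<open>f\<close> is controlled only on the positive reals; cutting it off gives
    a Borel function on the line that agrees with \<open>f\<close> wherever the density evaluates
    it.\<close>
  define fb where "fb t = indicator {0<..} t *\<^sub>R f t" for t :: real
  have [measurable]: "fb \<in> borel_measurable borel"
    unfolding fb_def using assms by (intro borel_measurable_continuous_on_indicator) auto
  have "(\<lambda>z. joint_density n f m s (fst z) (snd z)) =
      (\<lambda>z. if snd z > 0 then snd z ^ (n - 1) / s ^ (n + 1) * fb (((fst z - m)\<^sup>2 + (snd z)\<^sup>2) / s\<^sup>2) else 0)"
    using assms(2) by (auto simp: joint_density_def fb_def fun_eq_iff add_nonneg_pos)
  also have "\<dots> \<in> borel_measurable (borel \<Otimes>\<^sub>M borel)" by measurable
  finally show ?thesis .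
qed

text \<open>The Jacobian s^2 supplies the two powers missing between (s v)^(n - 1) and s^(n + 1);
  with truncated subtraction this count is right for n >= 1.\<close>

lemma joint_density_rescale:
  assumes "s > 0" "n \<ge> 1"
  shows "s\<^sup>2 * joint_density n f m s (m + s * u) (s * v) = joint_density n f 0 1 u v"
proof (cases "v > 0")
  case True
  have "s\<^sup>2 * ((s * v) ^ (n - 1) / s ^ (n + 1)) = v ^ (n - 1)"
    using assms by (cases n) (auto simp: power_mult_distrib field_simps power2_eq_square)
  moreover have "((s * u)\<^sup>2 + (s * v)\<^sup>2) / s\<^sup>2 = u\<^sup>2 + v\<^sup>2"
    using assms by (simp add: power_mult_distrib field_simps)
  moreover have "s\<^sup>2 * joint_density n f m s (m + s * u) (s * v)
      = s\<^sup>2 * ((s * v) ^ (n - 1) / s ^ (n + 1)) * f (((s * u)\<^sup>2 + (s * v)\<^sup>2) / s\<^sup>2)"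
    using True assms by (simp add: joint_density_def)
  ultimately show ?thesis
    using True by (simp only:) (simp add: joint_density_def)
next
  case False
  then show ?thesis using assms by (simp add: joint_density_def zero_less_mult_iff)
qed

text \<open>In the standardized variables the parameter survives only as the shift m / s in the
  argument of \<open>g\<close>, and it disappears when \<open>g\<close> is zero.\<close>

lemma risk_delta:
  assumes s: "s > 0" and n: "n \<ge> 1" and f: "continuous_on {0<..} f"
    and [measurable]: "\<rho> \<in> borel_measurable borel" "g \<in> borel_measurable borel"
  shows "risk n f \<rho> m s (delta c g) =
    (\<integral>\<^sup>+z. ennreal (\<rho> (fst z + c * snd z + g ((fst z + m / s) / snd z) * snd z))
       * ennreal (joint_density n f 0 1 (fst z) (snd z)) \<partial>lborel)"
proof -
  note [measurable] = joint_density_measurable[OF f s] joint_density_measurable[OF f zero_less_one]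
  have "risk n f \<rho> m s (delta c g) =
    (\<integral>\<^sup>+z. ennreal (joint_density n f m s (fst z) (snd z)) *
      ennreal (\<rho> ((fst z + c * snd z + g (fst z / snd z) * snd z - m) / s)) \<partial>lborel)"
    unfolding risk_def model_def delta_def delta0_def split_beta
    by (rule nn_integral_density; unfold lborel_prod[symmetric]; measurable)
  also have "\<dots> = ennreal (s\<^sup>2) * (\<integral>\<^sup>+z. ennreal (joint_density n f m s (m + s * fst z) (s * snd z)) *
      ennreal (\<rho> ((m + s * fst z + c * (s * snd z) + g ((m + s * fst z) / (s * snd z)) * (s * snd z) - m) / s)) \<partial>lborel)"
    by (subst nn_integral_lborel_affine_pair[OF _ s, of _ m], unfold borel_prod[symmetric], measurable)
  also have "\<dots> = (\<integral>\<^sup>+z. ennreal (s\<^sup>2) * (ennreal (joint_density n f m s (m + s * fst z) (s * snd z)) *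
      ennreal (\<rho> ((m + s * fst z + c * (s * snd z) + g ((m + s * fst z) / (s * snd z)) * (s * snd z) - m) / s))) \<partial>lborel)"
  proof (rule nn_integral_cmult[symmetric])
    have [measurable]: "(\<lambda>z. joint_density n f m s (m + s * fst z) (s * snd z)) \<in> borel_measurable (borel \<Otimes>\<^sub>M borel)"
      using measurable_compose[OF _ joint_density_measurable[OF f s],
          of "\<lambda>z. (m + s * fst z, s * snd z)" "borel \<Otimes>\<^sub>M borel"] by simp
    show "(\<lambda>z. ennreal (joint_density n f m s (m + s * fst z) (s * snd z)) *
      ennreal (\<rho> ((m + s * fst z + c * (s * snd z) + g ((m + s * fst z) / (s * snd z)) * (s * snd z) - m) / s)))
      \<in> borel_measurable lborel"
      unfolding lborel_prod[symmetric] by measurable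
  qed
  also have "\<dots> = (\<integral>\<^sup>+z. ennreal (\<rho> (fst z + c * snd z + g ((fst z + m / s) / snd z) * snd z))
       * ennreal (joint_density n f 0 1 (fst z) (snd z)) \<partial>lborel)"
  proof (rule nn_integral_cong)
    fix z :: "real \<times> real"
    have "(m + s * fst z) / (s * snd z) = (fst z + m / s) / snd z"
      using s by (simp add: field_simps)
    moreover have "(m + s * fst z + c * (s * snd z) + b * (s * snd z) - m) / s = fst z + c * snd z + b * snd z" for b
      using s by (simp add: field_simps)
    moreover have "ennreal (s\<^sup>2) * ennreal (joint_density n f m s (m + s * fst z) (s * snd z))
      = ennreal (joint_density n f 0 1 (fst z) (snd z))"
      by (subst ennreal_mult'[symmetric]) (simp_all add: joint_density_rescale[OF s n])
    ultimately show "ennreal (s\<^sup>2) * (ennreal (joint_density n f m s (m + s * fst z) (s * snd z)) *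
      ennreal (\<rho> ((m + s * fst z + c * (s * snd z) + g ((m + s * fst z) / (s * snd z)) * (s * snd z) - m) / s)))
      = ennreal (\<rho> (fst z + c * snd z + g ((fst z + m / s) / snd z) * snd z))
       * ennreal (joint_density n f 0 1 (fst z) (snd z))"
      by (simp add: mult.assoc[symmetric]) (simp add: mult.commute)
  qed
  finally show ?thesis .
qed

text \<open>Kubokawa's integral expression of risk difference: the increment of \<open>\<rho>\<close> along the segment from
  \<open>W\<close> to \<open>W + G V\<close> is written as an integral over the level \<open>k\<close> of \<open>G\<close>, and Tonelli exchanges it with the
  integral over the sample space. Positive and negative parts are kept separate, so that
  only the finiteness of the risk of the reference estimator is needed.\<close>

lemma risk_le_by_levels:
  fixes W G V :: "real \<times> real \<Rightarrow> real" and q :: "real \<times> real \<Rightarrow> ennreal"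
  assumes [measurable]: "r \<in> borel_measurable borel" "\<rho> \<in> borel_measurable borel"
      "W \<in> borel_measurable borel" "G \<in> borel_measurable borel" "V \<in> borel_measurable borel" "q \<in> borel_measurable borel"
    and ftc: "\<And>a b. a \<le> b \<Longrightarrow> ennreal (\<rho> b) + (\<integral>\<^sup>+x. ennreal (- r x) * indicator {a..b} x \<partial>lborel)
      = ennreal (\<rho> a) + (\<integral>\<^sup>+x. ennreal (r x) * indicator {a..b} x \<partial>lborel)"
    and fall: "\<And>a b. a \<le> b \<Longrightarrow> (\<integral>\<^sup>+x. ennreal (- r x) * indicator {a..b} x \<partial>lborel) \<le> ennreal (\<rho> a)"
    and G: "\<And>z. G z \<ge> 0" and q: "\<And>z. V z \<le> 0 \<Longrightarrow> q z = 0"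
    and finite: "(\<integral>\<^sup>+z. ennreal (\<rho> (W z)) * q z \<partial>lborel) < \<infinity>"
    and levels: "AE k in lborel. k > 0 \<longrightarrow>
      (\<integral>\<^sup>+z. ennreal (r (W z + V z * k) * V z) * indicator {..G z} k * q z \<partial>lborel)
      \<le> (\<integral>\<^sup>+z. ennreal (- r (W z + V z * k) * V z) * indicator {..G z} k * q z \<partial>lborel)"
  shows "(\<integral>\<^sup>+z. ennreal (\<rho> (W z + G z * V z)) * q z \<partial>lborel) \<le> (\<integral>\<^sup>+z. ennreal (\<rho> (W z)) * q z \<partial>lborel)"
proof -
  \<comment> \<open>The sign \<open>s\<close> = 1 or -1 selects the positive or the negative part of
    \<open>r\<close>, because \<open>ennreal\<close> sends negative numbers to 0.\<close>
  define J where "J s z k = ennreal (s * r (W z + V z * k) * V z) * indicator {0..G z} k * q z" for s z k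
  have J[measurable]: "(\<lambda>(z, k). J s z k) \<in> borel_measurable (lborel \<Otimes>\<^sub>M lborel)" for s
  proof -
    have "(\<lambda>(z, k). J s z k) = (\<lambda>(z, k). if 0 \<le> k \<and> k \<le> G z then ennreal (s * r (W z + V z * k) * V z) * q z else 0)"
      by (auto simp: J_def fun_eq_iff indicator_def)
    also have "\<dots> \<in> borel_measurable (lborel \<Otimes>\<^sub>M lborel)" by measurable
    finally show ?thesis .
  qed
  \<comment> \<open>The substitution x = W + V k carries levels to points of the segment; where V <=
    0, both sides vanish with \<open>q\<close>.\<close>
  have sub: "(\<integral>\<^sup>+k. J s z k \<partial>lborel) = (\<integral>\<^sup>+x. ennreal (s * r x) * indicator {W z..W z + G z * V z} x \<partial>lborel) * q z" for s z
  proof (cases "V z > 0")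
    case True
    have "(\<integral>\<^sup>+x. ennreal (s * r x) * indicator {W z..W z + G z * V z} x \<partial>lborel)
      = ennreal (V z) * (\<integral>\<^sup>+k. ennreal (s * r (W z + V z * k)) * indicator {W z..W z + G z * V z} (W z + V z * k) \<partial>lborel)"
      using True by (subst nn_integral_real_affine[where c = "V z" and t = "W z"]) auto
    also have "\<dots> = (\<integral>\<^sup>+k. ennreal (V z) * (ennreal (s * r (W z + V z * k)) * indicator {W z..W z + G z * V z} (W z + V z * k)) \<partial>lborel)"
      by (rule nn_integral_cmult[symmetric]) measurable
    also have "\<dots> = (\<integral>\<^sup>+k. ennreal (s * r (W z + V z * k) * V z) * indicator {0..G z} k \<partial>lborel)"
      using True by (intro nn_integral_cong)
        (auto simp: indicator_def ennreal_mult' zero_le_mult_iff mult.commute)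
    finally show ?thesis
      unfolding J_def by (subst nn_integral_multc) auto
  qed (simp add: J_def q)
  have point: "ennreal (\<rho> (W z + G z * V z)) * q z + (\<integral>\<^sup>+k. J (-1) z k \<partial>lborel) = ennreal (\<rho> (W z)) * q z + (\<integral>\<^sup>+k. J 1 z k \<partial>lborel)"
    and point_le: "(\<integral>\<^sup>+k. J (-1) z k \<partial>lborel) \<le> ennreal (\<rho> (W z)) * q z" for z
  proof -
    have le: "W z \<le> W z + G z * V z" if "V z > 0" using G[of z] that by simp
    show "ennreal (\<rho> (W z + G z * V z)) * q z + (\<integral>\<^sup>+k. J (-1) z k \<partial>lborel) = ennreal (\<rho> (W z)) * q z + (\<integral>\<^sup>+k. J 1 z k \<partial>lborel)"
      using ftc[OF le] q[of z] by (cases "V z > 0") (simp_all add: sub distrib_right[symmetric])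
    show "(\<integral>\<^sup>+k. J (-1) z k \<partial>lborel) \<le> ennreal (\<rho> (W z)) * q z"
      using fall[OF le] q[of z] by (cases "V z > 0") (simp_all add: sub mult_right_mono)
  qed
  let ?R = "\<integral>\<^sup>+z. ennreal (\<rho> (W z)) * q z \<partial>lborel"
    and ?Rg = "\<integral>\<^sup>+z. ennreal (\<rho> (W z + G z * V z)) * q z \<partial>lborel"
    and ?I = "\<lambda>s. \<integral>\<^sup>+z. (\<integral>\<^sup>+k. J s z k \<partial>lborel) \<partial>lborel"
  have "?Rg + ?I (-1) = (\<integral>\<^sup>+z. ennreal (\<rho> (W z + G z * V z)) * q z + (\<integral>\<^sup>+k. J (-1) z k \<partial>lborel) \<partial>lborel)"
    by (rule nn_integral_add[symmetric]) measurable
  also have "\<dots> = ?R + ?I 1"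
    unfolding point by (rule nn_integral_add) measurable
  finally have eq: "?Rg + ?I (-1) = ?R + ?I 1" .
  have swap: "?I s = (\<integral>\<^sup>+k. (\<integral>\<^sup>+z. J s z k \<partial>lborel) \<partial>lborel)" for s
    by (rule lborel_pair.Fubini'[symmetric]) measurable
  have AE0: "AE k in lborel. k \<noteq> (0::real)" by (rule AE_lborel_singleton)
  have "?I 1 \<le> ?I (-1)"
    unfolding swap
  proof (rule nn_integral_mono_AE)
    show "AE k in lborel. (\<integral>\<^sup>+z. J 1 z k \<partial>lborel) \<le> (\<integral>\<^sup>+z. J (-1) z k \<partial>lborel)"
      using levels AE0
    proof eventually_elim
      case (elim k)
      show ?case
      proof (cases "k > 0")
        case True
        then have "J s z k = ennreal (s * r (W z + V z * k) * V z) * indicator {..G z} k * q z" for s z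
          by (auto simp: J_def indicator_def)
        then show ?thesis using elim(1) True by simp
      next
        case False
        then have "J s z k = 0" for s z using elim(2) by (auto simp: J_def indicator_def)
        then show ?thesis by simp
      qed
    qed
  qed
  moreover have "?I (-1) \<le> ?R"
    by (rule nn_integral_mono) (rule point_le)
  \<comment> \<open>The integral of the negative part is dominated by the finite reference risk, so
    it can be cancelled from both sides.\<close>
  ultimately have "?I (-1) + ?Rg \<le> ?I (-1) + ?R" "?I (-1) \<noteq> \<infinity>"
    using eq finite by (auto simp: add.commute add_left_mono)
  then show ?thesis by (simp add: ennreal_add_left_cancel_le)
qed

section \<open>Level sets of \<open>g\<close>\<close>

text \<open>The set where g >= k is closed by continuity, bounded above because \<open>g\<close>
  tends to 0 < k, and downward closed by monotonicity: a half-line if nonempty. Its endpoint is the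
  rightmost point of level k, where the sign hypotheses will be applied.\<close>

lemma antimono_level_set:
  fixes g :: "real \<Rightarrow> real"
  assumes anti: "antimono g" and cont: "\<And>x. isCont g x" and lim: "(g \<longlongrightarrow> 0) at_top" and k: "k > 0"
  shows "(\<forall>y. g y < k) \<or> (\<exists>T. g T = k \<and> (\<forall>y. k \<le> g y \<longleftrightarrow> y \<le> T))"
proof (cases "\<exists>y. k \<le> g y")
  case True
  then obtain y0 where y0: "k \<le> g y0" by blast
  obtain y1 where y1: "g y1 < k"
    using order_tendstoD(2)[OF lim k] by (auto simp: eventually_at_top_linorder)
  let ?E = "{y. k \<le> g y}"
  have bdd: "bdd_above ?E"
  proof (rule bdd_aboveI[of _ y1])
    fix y assume "y \<in> ?E"
    then have "\<not> y1 \<le> y" using antimonoD[OF anti, of y1 y] y1 by auto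
    then show "y \<le> y1" by simp
  qed
  have "closed ?E"
    using cont by (intro closed_Collect_le continuous_on_const continuous_at_imp_continuous_on ballI)
  then have T: "k \<le> g (Sup ?E)"
    using closed_contains_Sup[OF _ bdd] y0 by auto
  have iff: "k \<le> g y \<longleftrightarrow> y \<le> Sup ?E" for y
    using cSup_upper[OF _ bdd, of y] T antimonoD[OF anti, of y "Sup ?E"] by auto
  have "g (Sup ?E) \<le> k"
  proof (rule ccontr)
    assume "\<not> g (Sup ?E) \<le> k"
    then have "eventually (\<lambda>y. k < g y) (at (Sup ?E))"
      using order_tendstoD(1)[OF cont[unfolded isCont_def]] by auto
    then obtain d where d: "d > 0" "\<And>y. y \<noteq> Sup ?E \<Longrightarrow> dist y (Sup ?E) < d \<Longrightarrow> k < g y"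
      by (auto simp: eventually_at)
    have "k < g (Sup ?E + d / 2)"
      using d(1) by (intro d(2)) (auto simp: dist_real_def)
    then show False using iff[of "Sup ?E + d / 2"] d(1) by simp
  qed
  then have "g (Sup ?E) = k" using T by (rule antisym)
  then show ?thesis by (intro disjI2 exI[of _ "Sup ?E"] conjI allI iff)
qed (auto simp: not_le)

text \<open>A level is discarded as soon as one point of that level is bad. The discarded levels are
  the reflection of the image of the bad points under the nondecreasing function -g, a null
  set.\<close>

lemma AE_level_has_neg_derivative:
  fixes g :: "real \<Rightarrow> real"
  assumes anti: "antimono g" and ac: "abs_continuous g"
  shows "AE k in lborel. \<forall>y. g y = k \<longrightarrow> (\<exists>D<0. (g has_real_derivative D) (at y))"
proof -
  let ?h = "\<lambda>x. - g x"
  let ?B = "{x. \<not> (\<exists>D>0. (?h has_real_derivative D) (at x))}"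
  have "negligible (?h ` ?B)"
    using antimonoD[OF anti] by (intro negligible_image_no_pos_derivative abs_continuous_uminus ac monoI) simp
  then have "negligible (uminus ` (?h ` ?B))"
    by (rule negligible_differentiable_image_negligible[OF order_refl])
       (auto intro!: derivative_intros simp: differentiable_on_def)
  then have "uminus ` (?h ` ?B) \<in> null_sets lebesgue"
    by (simp only: negligible_iff_null_sets)
  then have "AE k in lebesgue. k \<notin> uminus ` (?h ` ?B)"
    by (rule AE_not_in)
  then have "AE k in lborel. k \<notin> uminus ` (?h ` ?B)"
    by (simp only: AE_completion_iff)
  then show ?thesis
  proof eventually_elim
    case (elim k)
    show ?case
    proof (intro allI impI)
      fix y assume y: "g y = k"
      have "y \<notin> ?B"
      proof
        assume "y \<in> ?B"
        then have "- ?h y \<in> uminus ` (?h ` ?B)" by (intro imageI)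
        with elim y show False by (simp only: minus_minus)
      qed
      then obtain D where "D > 0" "(?h has_real_derivative D) (at y)" by auto
      then have "(g has_real_derivative - D) (at y)" using DERIV_minus[of ?h D y UNIV] by simp
      with \<open>D > 0\<close> show "\<exists>D<0. (g has_real_derivative D) (at y)" by (intro exI[of _ "- D"]) simp
    qed
  qed
qed

section \<open>Integrals over the lower regions\<close>

lemma lower_region_sets: "{(u, v). 0 < v \<and> u \<le> v * y - lam} \<in> sets (borel :: (real \<times> real) measure)"
proof -
  have "Measurable.pred (borel \<Otimes>\<^sub>M borel) (\<lambda>z :: real \<times> real. 0 < snd z \<and> fst z \<le> snd z * y - lam)"
    by measurable
  then show ?thesis
    by (simp add: pred_def borel_prod space_pair_measure case_prod_beta')
qed

lemma lower_integral_eq: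
  assumes "lower_integrable lam y \<phi>"
  shows "lower_integral lam y \<phi> = (\<integral>z. indicator {(u, v). 0 < v \<and> u \<le> v * y - lam} z * \<phi> (fst z) (snd z) \<partial>lborel)"
proof -
  let ?A = "{(u, v). 0 < v \<and> u \<le> v * y - lam}"
  have int: "integrable (lborel \<Otimes>\<^sub>M lborel) (\<lambda>(u, v). indicator ?A (u, v) * \<phi> u v)"
    using assms unfolding lower_integrable_def set_integrable_def lborel_prod by (simp add: case_prod_beta')
  have "lower_integral lam y \<phi> = (\<integral>v. (\<integral>u. indicator ?A (u, v) * \<phi> u v \<partial>lborel) \<partial>lborel)"
    unfolding lower_integral_def set_lebesgue_integral_def
    by (intro Bochner_Integration.integral_cong refl)
       (auto simp: indicator_def intro!: Bochner_Integration.integral_cong)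
  also have "\<dots> = (\<integral>(u, v). indicator ?A (u, v) * \<phi> u v \<partial>(lborel \<Otimes>\<^sub>M lborel))"
    by (rule lborel_pair.integral_snd[OF int])
  finally show ?thesis by (simp add: lborel_prod case_prod_beta')
qed

text \<open>Brings the sign condition into the form with separate parts used by
  \<open>risk_le_by_levels\<close>. Integrability makes both parts finite, so the comparison
  survives the return from \<open>enn2real\<close> to extended values.\<close>

lemma lower_integral_nonpos_parts:
  assumes int: "lower_integrable lam y \<phi>" and le: "lower_integral lam y \<phi> \<le> 0"
  shows "(\<integral>\<^sup>+z. ennreal (indicator {(u, v). 0 < v \<and> u \<le> v * y - lam} z * \<phi> (fst z) (snd z)) \<partial>lborel)
    \<le> (\<integral>\<^sup>+z. ennreal (- (indicator {(u, v). 0 < v \<and> u \<le> v * y - lam} z * \<phi> (fst z) (snd z))) \<partial>lborel)"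
proof -
  let ?f = "\<lambda>z. indicator {(u, v). 0 < v \<and> u \<le> v * y - lam} z * \<phi> (fst z) (snd z)"
  have f: "integrable lborel ?f"
    using int unfolding lower_integrable_def set_integrable_def by (simp add: case_prod_beta')
  have "integral\<^sup>L lborel ?f = enn2real (\<integral>\<^sup>+z. ennreal (?f z) \<partial>lborel) - enn2real (\<integral>\<^sup>+z. ennreal (- ?f z) \<partial>lborel)"
    by (rule real_lebesgue_integral_def[OF f])
  moreover have "integral\<^sup>L lborel ?f \<le> 0"
    using le by (simp add: lower_integral_eq[OF int])
  ultimately have "enn2real (\<integral>\<^sup>+z. ennreal (?f z) \<partial>lborel) \<le> enn2real (\<integral>\<^sup>+z. ennreal (- ?f z) \<partial>lborel)"
    by simp
  moreover have "(\<integral>\<^sup>+z. ennreal (?f z) \<partial>lborel) < \<infinity>" "(\<integral>\<^sup>+z. ennreal (- ?f z) \<partial>lborel) < \<infinity>"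
    using f by (auto simp: real_integrable_def less_top)
  moreover have "a \<le> b" if "enn2real a \<le> enn2real b" "a < \<infinity>" "b < \<infinity>" for a b :: ennreal
    using that by (cases a; cases b) auto
  ultimately show ?thesis by blast
qed

text \<open>A larger shift shrinks the region. The convergence at shift 0 that comes with the Bayes
  function thus extends to \<open>psi\<close> at every \<lambda> >= 0, where condition (ii) itself
  gives only a sign.\<close>

lemma lower_integrable_mono:
  assumes "lower_integrable a y \<phi>" "a \<le> b"
  shows "lower_integrable b y \<phi>"
  using assms lower_region_sets[of y b] unfolding lower_integrable_def
  by (elim set_integrable_subset) auto

text \<open>The comparison slope \<open>k'\<close> is \<open>g y\<close> itself under the first condition
  and the Bayes value under the second one.\<close>

lemma risk_level_le:
  assumes n: "n \<ge> 1" and fpos: "\<And>t. t > 0 \<Longrightarrow> f t > 0"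
    and r: "AE x in lborel. (\<rho> has_real_derivative r x) (at x)"
    and k': "k' = k \<or> (k \<le> k' \<and> convex_on UNIV \<rho>)"
    and int: "lower_integrable lam y (score_integrand n f \<rho> c k')"
    and le: "lower_integral lam y (score_integrand n f \<rho> c k') \<le> 0"
    and level: "\<And>z. snd z > 0 \<Longrightarrow> k \<le> G z \<longleftrightarrow> fst z \<le> snd z * y - lam"
  shows "(\<integral>\<^sup>+z. ennreal (r (fst z + c * snd z + snd z * k) * snd z) * indicator {..G z} k
        * ennreal (joint_density n f 0 1 (fst z) (snd z)) \<partial>lborel)
    \<le> (\<integral>\<^sup>+z. ennreal (- r (fst z + c * snd z + snd z * k) * snd z) * indicator {..G z} k
        * ennreal (joint_density n f 0 1 (fst z) (snd z)) \<partial>lborel)"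
proof -
  let ?A = "{(u, v). 0 < v \<and> u \<le> v * y - lam}"
  let ?f = "\<lambda>z. indicator ?A z * score_integrand n f \<rho> c k' (fst z) (snd z)"
  \<comment> \<open>The factor v from the level integral raises the power v^(n - 1) of the density
    to the v^n of the score, and \<open>level\<close> turns the indicator into that of the
    region.\<close>
  have integrand: "ennreal (a * snd z) * indicator {..G z} k * ennreal (joint_density n f 0 1 (fst z) (snd z))
      = ennreal (indicator ?A z * (a * snd z ^ n * f ((fst z)\<^sup>2 + (snd z)\<^sup>2)))" for a z
  proof (cases "snd z > 0")
    case True
    then have "f ((fst z)\<^sup>2 + (snd z)\<^sup>2) > 0"
      by (intro fpos) (simp add: add_nonneg_pos)
    moreover have "snd z ^ n = snd z * snd z ^ (n - 1)"
      using n by (cases n) auto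
    ultimately show ?thesis
      using True level[OF True] by (auto simp: indicator_def joint_density_def case_prod_beta' ennreal_mult''[symmetric] mult.assoc)
  qed (auto simp: joint_density_def indicator_def)
  have AE_k: "AE z in lborel. (\<rho> has_real_derivative r (fst z + c * snd z + snd z * k)) (at (fst z + c * snd z + snd z * k))" for k
    using AE_lborel_shear[OF r, of "c + k"] by (simp add: case_prod_beta' algebra_simps)
  \<comment> \<open>For \<open>k' = k\<close> both sides agree almost everywhere. Otherwise v > 0
    places the argument at level \<open>k\<close> to the left of the one at \<open>k'\<close>, and
    convexity orders the derivatives.\<close>
  have AE_le: "AE z in lborel. indicator ?A z * r (fst z + c * snd z + snd z * k)
      \<le> indicator ?A z * deriv \<rho> (fst z + c * snd z + k' * snd z)"
    using AE_k[of k] AE_k[of k']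
  proof eventually_elim
    case (elim z)
    have "r (fst z + c * snd z + snd z * k) \<le> r (fst z + c * snd z + snd z * k')" if "snd z > 0"
      using k' derivative_mono_convex[OF _ _ elim] that by auto
    moreover have "deriv \<rho> (fst z + c * snd z + k' * snd z) = r (fst z + c * snd z + snd z * k')"
      using DERIV_imp_deriv[OF elim(2)] by (simp add: mult.commute)
    ultimately show ?case by (auto simp: indicator_def)
  qed
  have pt: "indicator ?A z * (r (fst z + c * snd z + snd z * k) * snd z ^ n * f ((fst z)\<^sup>2 + (snd z)\<^sup>2)) \<le> ?f z"
    if "indicator ?A z * r (fst z + c * snd z + snd z * k) \<le> indicator ?A z * deriv \<rho> (fst z + c * snd z + k' * snd z)" for z
  proof (cases "z \<in> ?A")
    case True
    then have v: "snd z > 0" by auto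
    then have f: "f ((fst z)\<^sup>2 + (snd z)\<^sup>2) > 0"
      by (intro fpos) (simp add: add_nonneg_pos)
    have "r (fst z + c * snd z + snd z * k) \<le> deriv \<rho> (fst z + c * snd z + k' * snd z)"
      using that True by simp
    then show ?thesis using True v f
      by (simp add: score_integrand_def mult_right_mono)
  qed simp
  have "(\<integral>\<^sup>+z. ennreal (indicator ?A z * (r (fst z + c * snd z + snd z * k) * snd z ^ n * f ((fst z)\<^sup>2 + (snd z)\<^sup>2))) \<partial>lborel)
      \<le> (\<integral>\<^sup>+z. ennreal (?f z) \<partial>lborel)"
    by (rule nn_integral_mono_AE, use AE_le in eventually_elim) (rule ennreal_leI, rule pt)
  \<comment> \<open>Passing from \<open>k\<close> to \<open>k'\<close> raises the positive part and
    lowers the negative one, so the inequality known at \<open>k'\<close> sits between the two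
    comparisons.\<close>
  also have "\<dots> \<le> (\<integral>\<^sup>+z. ennreal (- ?f z) \<partial>lborel)"
    by (rule lower_integral_nonpos_parts[OF int le])
  also have "\<dots> \<le> (\<integral>\<^sup>+z. ennreal (indicator ?A z * (- r (fst z + c * snd z + snd z * k) * snd z ^ n * f ((fst z)\<^sup>2 + (snd z)\<^sup>2))) \<partial>lborel)"
  proof (rule nn_integral_mono_AE, use AE_le in eventually_elim)
    case (elim z)
    show ?case using pt[OF elim] by (intro ennreal_leI) simp
  qed
  finally show ?thesis unfolding integrand .
qed

theorem theorem1:
  fixes n :: nat and f \<rho> g g\<^sub>\<pi> :: "real \<Rightarrow> real" and c\<^sub>0 :: real
  assumes "n \<ge> 1"
    and "model_density n f"
    and "strictly_bowl_shaped \<rho>"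
    and "MRE_constant n f \<rho> c\<^sub>0"
    and "Bayes_function n f \<rho> c\<^sub>0 g\<^sub>\<pi>"
    and "class_C g"
    and "(\<forall>lam\<ge>0. \<forall>y. (\<exists>D<0. (g has_real_derivative D) (at y)) \<longrightarrow>
            lower_integrable lam y (score_integrand n f \<rho> c\<^sub>0 (g y)) \<and>
            lower_integral lam y (score_integrand n f \<rho> c\<^sub>0 (g y)) \<le> 0)
       \<or> (convex_on UNIV \<rho> \<and> g \<le> g\<^sub>\<pi> \<and>
          (\<forall>lam\<ge>0. \<forall>y. (\<exists>D<0. (g has_real_derivative D) (at y)) \<longrightarrow>
            psi n f \<rho> c\<^sub>0 g\<^sub>\<pi> lam y \<le> 0))"
  shows "minimax n f \<rho> c\<^sub>0 (delta c\<^sub>0 g)"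
  unfolding minimax_def
proof (intro allI impI, elim conjE)
  fix \<mu> \<sigma> :: real assume \<mu>: "\<mu> \<ge> 0" and \<sigma>: "\<sigma> > 0"
  obtain r where r: "r \<in> borel_measurable borel" "AE x in lborel. (\<rho> has_real_derivative r x) (at x)"
    "\<forall>a b. a \<le> b \<longrightarrow> ennreal (\<rho> b) + (\<integral>\<^sup>+x. ennreal (- r x) * indicator {a..b} x \<partial>lborel)
      = ennreal (\<rho> a) + (\<integral>\<^sup>+x. ennreal (r x) * indicator {a..b} x \<partial>lborel)"
    "\<forall>a b. a \<le> b \<longrightarrow> (\<integral>\<^sup>+x. ennreal (- r x) * indicator {a..b} x \<partial>lborel) \<le> ennreal (\<rho> a)"
    by (rule strictly_bowl_shaped_derivative[OF assms(3)])
  have g: "abs_continuous g" "antimono g" "(g \<longlongrightarrow> 0) at_top"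
    using assms(6) by (auto simp: class_C_def)
  have fpos: "f t > 0" if "t > 0" for t
    using assms(2) that by (auto simp: model_density_def)
  have fcont: "continuous_on {0<..} f"
    using assms(2) by (intro continuous_at_imp_continuous_on ballI differentiable_imp_continuous_within)
      (auto simp: model_density_def)
  have cont: "continuous_on UNIV F" if "abs_continuous F" for F
    using abs_continuous_isCont[OF that] by (simp add: continuous_at_imp_continuous_on)
  have \<rho>m[measurable]: "\<rho> \<in> borel_measurable borel"
    using assms(3) by (intro borel_measurable_continuous_onI cont) (auto simp: strictly_bowl_shaped_def)
  have gm[measurable]: "g \<in> borel_measurable borel"
    using g by (intro borel_measurable_continuous_onI cont)
  have g_nonneg: "g y \<ge> 0" for y
  proof (rule tendsto_upperbound[OF g(3)])
    show "eventually (\<lambda>x. g x \<le> g y) at_top"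
      using eventually_ge_at_top[of y] by eventually_elim (rule antimonoD[OF g(2)])
  qed simp
  define lam where "lam = \<mu> / \<sigma>"
  \<comment> \<open>The constraint on \<mu> becomes \<lambda> >= 0, the range covered by the sign
    hypotheses.\<close>
  have lam: "lam \<ge> 0" using \<mu> \<sigma> by (simp add: lam_def)
  let ?q = "\<lambda>z. ennreal (joint_density n f 0 1 (fst z) (snd z))"
  let ?W = "\<lambda>z. fst z + c\<^sub>0 * snd z"
  let ?G = "\<lambda>z. g ((fst z + lam) / snd z)"
  \<comment> \<open>With the reference estimator as the case of zero correction, one formula
    expresses both risks.\<close>
  have delta0: "delta0 c\<^sub>0 = delta c\<^sub>0 (\<lambda>_. 0)"
    by (simp add: delta_def fun_eq_iff)
  have risk0: "risk n f \<rho> \<mu> \<sigma> (delta0 c\<^sub>0) = (\<integral>\<^sup>+z. ennreal (\<rho> (?W z)) * ?q z \<partial>lborel)"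
    unfolding delta0 by (subst risk_delta[OF \<sigma> assms(1) fcont]) simp_all
  have riskg: "risk n f \<rho> \<mu> \<sigma> (delta c\<^sub>0 g) = (\<integral>\<^sup>+z. ennreal (\<rho> (?W z + ?G z * snd z)) * ?q z \<partial>lborel)"
    unfolding lam_def by (rule risk_delta[OF \<sigma> assms(1) fcont]) simp_all
  have finite: "risk n f \<rho> \<mu> \<sigma> (delta0 c\<^sub>0) < \<infinity>"
    using assms(4) \<sigma> by (auto simp: MRE_constant_def unique_MRE_def)
  have levels: "AE k in lborel. k > 0 \<longrightarrow>
      (\<integral>\<^sup>+z. ennreal (r (?W z + snd z * k) * snd z) * indicator {..?G z} k * ?q z \<partial>lborel)
      \<le> (\<integral>\<^sup>+z. ennreal (- r (?W z + snd z * k) * snd z) * indicator {..?G z} k * ?q z \<partial>lborel)"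
    using AE_level_has_neg_derivative[OF g(2,1)]
  proof (eventually_elim, intro impI)
    fix k :: real
    assume der: "\<forall>y. g y = k \<longrightarrow> (\<exists>D<0. (g has_real_derivative D) (at y))" and k: "k > 0"
    consider "\<forall>y. g y < k" | T where "g T = k" "\<forall>y. k \<le> g y \<longleftrightarrow> y \<le> T"
      using antimono_level_set[OF g(2) abs_continuous_isCont[OF g(1)] g(3) k] by blast
    then show "(\<integral>\<^sup>+z. ennreal (r (?W z + snd z * k) * snd z) * indicator {..?G z} k * ?q z \<partial>lborel)
      \<le> (\<integral>\<^sup>+z. ennreal (- r (?W z + snd z * k) * snd z) * indicator {..?G z} k * ?q z \<partial>lborel)"
    proof cases
      case 1
      \<comment> \<open>A level above all values of \<open>g\<close> contributes nothing to either
        side.\<close>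
      then have "indicator {..?G z} k = (0 :: ennreal)" for z by (simp add: not_le)
      then show ?thesis by simp
    next
      case (2 T)
      \<comment> \<open>For a level outside the null set, every point of that level has a negative
        derivative, so the hypotheses are available at \<open>T\<close>.\<close>
      have D: "\<exists>D<0. (g has_real_derivative D) (at T)" using der 2(1) by blast
      have level: "k \<le> ?G z \<longleftrightarrow> fst z \<le> snd z * T - lam" if "snd z > 0" for z
        using 2(2) that by (simp add: field_simps)
      show ?thesis
        using assms(7)
      proof (elim disjE conjE)
        assume "\<forall>lam\<ge>0. \<forall>y. (\<exists>D<0. (g has_real_derivative D) (at y)) \<longrightarrow>
            lower_integrable lam y (score_integrand n f \<rho> c\<^sub>0 (g y)) \<and>
            lower_integral lam y (score_integrand n f \<rho> c\<^sub>0 (g y)) \<le> 0"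
        then have "lower_integrable lam T (score_integrand n f \<rho> c\<^sub>0 k)"
          "lower_integral lam T (score_integrand n f \<rho> c\<^sub>0 k) \<le> 0"
          using lam D 2(1) by auto
        then show ?thesis
          by (intro risk_level_le[OF assms(1) fpos r(2) disjI1[OF refl] _ _ level])
      next
        assume convex: "convex_on UNIV \<rho>" and le: "g \<le> g\<^sub>\<pi>"
          and psi: "\<forall>lam\<ge>0. \<forall>y. (\<exists>D<0. (g has_real_derivative D) (at y)) \<longrightarrow> psi n f \<rho> c\<^sub>0 g\<^sub>\<pi> lam y \<le> 0"
        have "lower_integrable 0 T (score_integrand n f \<rho> c\<^sub>0 (g\<^sub>\<pi> T))"
          using assms(5) by (auto simp: Bayes_function_def)
        then have int: "lower_integrable lam T (score_integrand n f \<rho> c\<^sub>0 (g\<^sub>\<pi> T))"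
          using lam by (rule lower_integrable_mono)
        have "k \<le> g\<^sub>\<pi> T" using le 2(1) by (auto simp: le_fun_def)
        with convex have "g\<^sub>\<pi> T = k \<or> (k \<le> g\<^sub>\<pi> T \<and> convex_on UNIV \<rho>)" by simp
        moreover have "lower_integral lam T (score_integrand n f \<rho> c\<^sub>0 (g\<^sub>\<pi> T)) \<le> 0"
          using psi lam D by (auto simp: psi_def)
        ultimately show ?thesis
          using int by (intro risk_level_le[OF assms(1) fpos r(2) _ _ _ level])
      qed
    qed
  qed
  have meas: "fst \<in> borel_measurable (borel :: (real \<times> real) measure)" "snd \<in> borel_measurable (borel :: (real \<times> real) measure)"
    by (simp_all flip: borel_prod)
  show "risk n f \<rho> \<mu> \<sigma> (delta c\<^sub>0 g) \<le> risk n f \<rho> \<mu> \<sigma> (delta0 c\<^sub>0)"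
    unfolding risk0 riskg
  proof (rule risk_le_by_levels[OF r(1) \<rho>m _ _ meas(2) _ r(3)[rule_format] r(4)[rule_format] g_nonneg _ _ levels])
    show "?W \<in> borel_measurable borel" "?G \<in> borel_measurable borel" "?q \<in> borel_measurable borel"
      using joint_density_measurable[OF fcont zero_less_one] by (simp_all flip: borel_prod)
  qed (use finite risk0 in \<open>auto simp: joint_density_def\<close>)
qed

end
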